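(* Let $n,k\ge1$ be integers and $M\sim\mathrm{GUE}_n$. Then $$\operatorname E\big[\det M^k\big]=\begin{cases}\displaystyle\prod_{i=1}^{n}\prod_{j=1}^{k/2}\Big(2\Big\lfloor\frac i2\Big\rfloor+2j-1\Big)&\text{if }k\text{ is even},\\[2ex]\displaystyle(-1)^{nk/2}\prod_{i=1}^{k}\prod_{j=1}^{n/2}\Big(2\Big\lfloor\frac i2\Big\rfloor+2j-1\Big)&\text{if }n\text{ is even},\\[2ex]0&\text{if }n\text{ and }k\text{ are both odd}.\end{cases}$$ (When $n$ and $k$ are both even, both of the first two formulas are valid.)
   Context: $\mathrm{GUE}_n$ is the law of $\frac12(G+G^{\mathrm H})$, where $G$ is an $n\times n$ matrix whose entries have real and imaginary parts that are all independent standard normal, and $G^{\mathrm H}$ is the conjugate transpose. (So diagonal entries are standard normal, and the real and imaginary parts of entries above the diagonal are independent normals of mean $0$ and variance $\frac12$.) *)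

theory Defs
  imports "HOL-Probability.Probability"
begin

definition conj_transpose :: "complex ^ 'n ^ 'm \<Rightarrow> complex ^ 'm ^ 'n" where
  "conj_transpose G = (\<chi> i j. cnj (G $ j $ i))"

definition std_normal :: "real measure" where
  "std_normal = density lborel std_normal_density"

text \<open>
  Independence of all the real and imaginary parts is expressed by a product measure:
  the coordinate (i, j, False) is the real part and (i, j, True) the imaginary part of
  the entry in row i and column j.
\<close>

definition entry_space :: "('n::finite \<times> 'n \<times> bool \<Rightarrow> real) measure" where
  "entry_space = PiM UNIV (\<lambda>_. std_normal)"

definition entry_matrix :: "('n::finite \<times> 'n \<times> bool \<Rightarrow> real) \<Rightarrow> complex ^ 'n ^ 'n" where
  "entry_matrix x = (\<chi> i j. Complex (x (i, j, False)) (x (i, j, True)))"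

definition ginibre :: "(complex ^ 'n ^ 'n::finite) measure" where
  "ginibre = distr entry_space borel entry_matrix"

definition GUE :: "(complex ^ 'n ^ 'n::finite) measure" where
  "GUE = distr ginibre borel (\<lambda>G. (1/2) *\<^sub>R (G + conj_transpose G))"

text \<open>
  The two pushforwards above are along measurable maps, so both are probability
  measures rather than degenerate values of \<^const>\<open>distr\<close>.
\<close>

lemma prob_space_entry_space: "prob_space entry_space"
  unfolding entry_space_def std_normal_def
  by (intro prob_space_PiM prob_space_normal_density) simp

lemma borel_measurable_entry_matrix:
  "entry_matrix \<in> borel_measurable (entry_space :: ('n::finite \<times> 'n \<times> bool \<Rightarrow> real) measure)"
proof -
  have coord: "(\<lambda>x. x c) \<in> borel_measurable
      (entry_space :: ('n \<times> 'n \<times> bool \<Rightarrow> real) measure)" for c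
  proof -
    have "(\<lambda>x. x c) \<in> measurable (entry_space :: ('n \<times> 'n \<times> bool \<Rightarrow> real) measure) std_normal"
      unfolding entry_space_def by (rule measurable_component_singleton) simp
    then show ?thesis
      by (simp add: std_normal_def)
  qed
  show ?thesis
  proof (rule borel_measurable_euclidean_space[THEN iffD2], rule ballI)
    fix b :: "complex ^ 'n ^ 'n"
    have "(\<lambda>x. entry_matrix x \<bullet> b) =
        (\<lambda>x. \<Sum>i\<in>UNIV. \<Sum>j\<in>UNIV. x (i, j, False) * Re (b $ i $ j) + x (i, j, True) * Im (b $ i $ j))"
      by (simp add: entry_matrix_def inner_vec_def inner_complex_def)
    then show "(\<lambda>x. entry_matrix x \<bullet> b) \<in> borel_measurable entry_space"
      using coord by simp
  qed
qed

lemma borel_measurable_hermitization: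
  "(\<lambda>G :: complex ^ 'n ^ 'n::finite. (1/2) *\<^sub>R (G + conj_transpose G)) \<in> borel_measurable borel"
  unfolding conj_transpose_def
  by (intro borel_measurable_continuous_onI continuous_intros)

lemma prob_space_ginibre: "prob_space (ginibre :: (complex ^ 'n ^ 'n::finite) measure)"
  unfolding ginibre_def
  by (intro prob_space.prob_space_distr prob_space_entry_space borel_measurable_entry_matrix)

lemma prob_space_GUE: "prob_space (GUE :: (complex ^ 'n ^ 'n::finite) measure)"
proof -
  have "(\<lambda>G :: complex ^ 'n ^ 'n. (1/2) *\<^sub>R (G + conj_transpose G)) \<in> measurable ginibre borel"
    using borel_measurable_hermitization by (simp add: ginibre_def measurable_distr_eq1)
  then show ?thesis
    unfolding GUE_def by (intro prob_space.prob_space_distr prob_space_ginibre)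
qed

end

theory Submission
  imports Defs
begin

text \<open>
  One step of Householder tridiagonalisation, carried out on moments. Write \<open>d\<^sub>S\<close> for the
  principal minor of the matrix on the index set \<open>S\<close>. For \<open>r\<close> outside \<open>S\<close> the minor
  on \<open>S \<union> {r}\<close> is \<open>a d\<^sub>S + q\<close>, where \<open>a\<close> is the diagonal entry at \<open>r\<close> and
  \<open>q\<close> is the determinant bordered by the column \<open>b\<close> of entries \<open>(i, r)\<close>, \<open>i \<in> S\<close>.
  The law is invariant under unitary conjugation, so given \<open>b\<close> one may rotate \<open>b\<close> onto
  a coordinate axis \<open>s \<in> S\<close>, and then \<open>q\<close> becomes minus the squared norm of \<open>b\<close>
  times the minor on \<open>S - {s}\<close>. As that squared norm is Gamma distributed with parameter
  \<open>card S\<close>, the joint moments of \<open>d\<^sub>S\<close> and the minor on \<open>S - {s}\<close> satisfy a recursion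
  in the size of \<open>S\<close>. They have a closed product form, for which each step of the recursion is
  an instance of the Chu--Vandermonde identity.
\<close>

section \<open>The recursion for the joint moments\<close>

text \<open>The dimension is a type, so no induction can shrink the matrix: every minor is a
  full-size determinant padded with the identity, and the induction runs over index sets. Moments of
  a single minor do not close under bordering, because the new minor involves two older ones; the
  pair of consecutive minors does. Expanding the power of a d + q gives terms a^l d^(l+j) q^(i-l),
  and q^(i-l) becomes a power of the next smaller minor, so the exponents (i, j) lead to the
  exponents (l + j, i - l). The rotation depends on b; it is chosen only after b has been frozen by
  Fubini, when it is a constant matrix. The symmetry H -> -H multiplies the product of d_n^i and
  d_(n-1)^j by (-1)^(n i + (n-1) j): this explains why half of the joint moments are zero and why
  the closed form has two branches. In the surviving cases only even powers l = 2 L of a contribute,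
  and splitting rising factorials by parity turns each sum into Chu-Vandermonde form.\<close>

definition normal_moment :: "nat \<Rightarrow> real" where
  "normal_moment l = (if even l then fact l / (2 ^ (l div 2) * fact (l div 2)) else 0)"

text \<open>
  \<open>minor_moment n i j\<close> is the expectation of \<open>d\<^sub>n ^ i * d\<^sub>n\<^sub>-\<^sub>1 ^ j\<close>, where \<open>d\<^sub>k\<close> is the leading
  principal minor of size \<open>k\<close>; \<open>minor_moment_even m i c\<close> is the case \<open>n = 2 * m + 2\<close>,
  \<open>j = 2 * c\<close>, and \<open>minor_moment_odd m c j\<close> is the case \<open>n = 2 * m + 1\<close>, \<open>i = 2 * c\<close>.
\<close>

definition minor_moment_even :: "nat \<Rightarrow> nat \<Rightarrow> nat \<Rightarrow> real" where
  "minor_moment_even m i c = (- 1) ^ (Suc m * i) * 2 ^ (Suc m * i + (2 * m + 1) * c) *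
     pochhammer (1/2) ((i + 1) div 2) * pochhammer (1/2) c *
     (\<Prod>t = 1..m. pochhammer (real t + 1/2) (c + i div 2) * pochhammer (real t + 1/2) (c + (i + 1) div 2)) *
     pochhammer (real m + 3/2) (c + i div 2) / pochhammer (real m + 3/2) c"

definition minor_moment_odd :: "nat \<Rightarrow> nat \<Rightarrow> nat \<Rightarrow> real" where
  "minor_moment_odd m c j = (- 1) ^ (m * j) * 2 ^ ((2 * m + 1) * c + m * j) *
     pochhammer (1/2) c *
     (\<Prod>t = 1..m. pochhammer (real t + 1/2) (c + j div 2) * pochhammer (real t + 1/2) (c + (j + 1) div 2)) *
     pochhammer (1/2) ((j + 1) div 2) / pochhammer (real m + 1/2) ((j + 1) div 2)"

definition minor_moment :: "nat \<Rightarrow> nat \<Rightarrow> nat \<Rightarrow> real" where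
  "minor_moment n i j =
    (if even n then (if even j then minor_moment_even (n div 2 - 1) i (j div 2) else 0)
     else (if even i then minor_moment_odd (n div 2) (i div 2) j else 0))"

section \<open>Rising factorials split by parity\<close>

text \<open>Factors at even offsets are \<open>2 * (z + k)\<close>, those at odd offsets
  \<open>2 * (z + 1/2 + k)\<close>; there are \<open>(n + 1) div 2\<close> of the former and
  \<open>n div 2\<close> of the latter. This is the duplication formula for both parities of
  \<open>n\<close> at once.\<close>

lemma pochhammer_parity:
  fixes z :: "'a::field_char_0"
  shows "pochhammer (2 * z) n = 2 ^ n * pochhammer z ((n + 1) div 2) * pochhammer (z + 1/2) (n div 2)"
proof (cases "even n")
  case True
  then obtain k where "n = 2 * k" by blast
  then show ?thesis by (simp add: pochhammer_double)
next
  case False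
  then obtain k where n: "n = 2 * k + 1" by (blast elim: oddE)
  have "pochhammer (2 * z) n = 2 ^ (2 * k) * pochhammer z k * pochhammer (z + 1/2) k * (2 * (z + of_nat k))"
    unfolding n add.commute[of "2 * k"] plus_1_eq_Suc pochhammer_Suc pochhammer_double
    by (simp add: algebra_simps)
  then show ?thesis
    by (simp add: n pochhammer_Suc algebra_simps)
qed

lemma fact_parity:
  "(fact n :: 'a::field_char_0) = 2 ^ n * pochhammer (1/2) ((n + 1) div 2) * fact (n div 2)"
  using pochhammer_parity[of "1/2 :: 'a" n] by (simp add: pochhammer_fact)

lemma sum_even_indices:
  fixes f :: "nat \<Rightarrow> 'a::comm_monoid_add"
  assumes "\<And>l. odd l \<Longrightarrow> f l = 0"
  shows "(\<Sum>l\<le>i. f l) = (\<Sum>k\<le>i div 2. f (2 * k))"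
proof -
  have "(\<Sum>l\<le>i. f l) = (\<Sum>l\<in>(*) 2 ` {..i div 2}. f l)"
  proof (rule sum.mono_neutral_right)
    show "\<forall>l\<in>{..i} - (*) 2 ` {..i div 2}. f l = 0"
    proof
      fix l assume "l \<in> {..i} - (*) 2 ` {..i div 2}"
      then have "odd l" by (auto elim!: evenE)
      then show "f l = 0" by (rule assms)
    qed
  qed auto
  also have "\<dots> = (\<Sum>k\<le>i div 2. f (2 * k))"
    by (subst sum.reindex) (auto simp: inj_on_def)
  finally show ?thesis .
qed

lemma binomial_normal_moment:
  assumes "2 * k \<le> i"
  shows "real (i choose (2 * k)) * normal_moment (2 * k) = fact i / (2 ^ k * fact k * fact (i - 2 * k))"
  using assms by (simp add: normal_moment_def binomial_fact field_simps)

lemma pochhammer_nonzero: "a > 0 \<Longrightarrow> pochhammer (a::real) n \<noteq> 0"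
  using pochhammer_pos[of a n] by simp

section \<open>The closed form satisfies the recursion\<close>

text \<open>Passage from size 2 m + 2 to size 2 m + 3. With c = I - L, duplication splits
  \<open>pochhammer (real (2 * m + 2)) (2 * c)\<close> in two: the half based at m + 3/2 cancels the
  denominator of \<open>minor_moment_even\<close>, the half based at m + 1 survives. The factor
  \<open>pochhammer (1/2) c\<close> cancels against \<open>fact (2 * c)\<close>. No sign appears,
  since the exponent 2 I - 2 L is even.\<close>

lemma minor_moment_odd_rec:
  "minor_moment_odd (Suc m) I j = (\<Sum>L\<le>I. real (2 * I choose (2 * L)) * normal_moment (2 * L) *
      pochhammer (real (2 * m + 2)) (2 * I - 2 * L) * minor_moment_even m (2 * L + j) (I - L))" (is "_ = ?R")
proof -
  define e where "e = (j + 1) div 2"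
  define f where "f = j div 2"
  define K where "K = (\<Prod>t = 1..m. pochhammer (real t + 1/2) (I + f) * pochhammer (real t + 1/2) (I + e))"
  \<comment> \<open>\<open>C\<close> collects all factors free of \<open>L\<close>; what remains is
    a Chu-Vandermonde summand with parameters 1/2 + e and m + 1.\<close>
  define C where "C = fact (2 * I) / fact I * (-1) ^ (Suc m * j) * 2 ^ ((2 * m + 1) * I + Suc m * j)
     * pochhammer (1/2) e * K * pochhammer (real m + 3/2) (I + f)"
  have "real (2 * I choose (2 * L)) * normal_moment (2 * L) *
      pochhammer (real (2 * m + 2)) (2 * I - 2 * L) * minor_moment_even m (2 * L + j) (I - L)
     = C * (real (I choose L) * pochhammer (1/2 + real e) L * pochhammer (real m + 1) (I - L))" if "L \<le> I" for L
  proof -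
    define c where "c = I - L"
    have I: "I = L + c" using that by (simp add: c_def)
    have p: "pochhammer (real (2 * m + 2)) (2 * c) = 2 ^ (2 * c) * pochhammer (real m + 1) c * pochhammer (real m + 3/2) c"
      using pochhammer_double[of "real m + 1" c] by (simp add: algebra_simps)
    have q: "fact (2 * c) = 2 ^ (2 * c) * pochhammer (1/2) c * (fact c :: real)"
      using fact_parity[of "2 * c", where 'a = real] by simp
    have d1: "(2 * L + j) div 2 = L + f" "(2 * L + j + 1) div 2 = L + e"
      by (auto simp: e_def f_def)
    have me: "minor_moment_even m (2 * L + j) c = (-1) ^ (Suc m * j) * 2 ^ (Suc m * (2 * L + j) + (2 * m + 1) * c) *
      pochhammer (1/2) (L + e) * pochhammer (1/2) c * K * pochhammer (real m + 3/2) (I + f) / pochhammer (real m + 3/2) c"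
    proof -
      have "(-1::real) ^ (Suc m * (2 * L + j)) = (-1) ^ (Suc m * j)"
        by (simp add: minus_one_power_iff)
      then show ?thesis
        unfolding minor_moment_even_def d1 K_def I by (simp only: ac_simps)
    qed
    have pe: "pochhammer (1/2) (L + e) = pochhammer (1/2::real) e * pochhammer (1/2 + real e) L"
      using pochhammer_product'[of "1/2::real" e L] by (simp add: add.commute)
    have pw: "(2::real) ^ (Suc m * (2 * L + j) + (2 * m + 1) * c) = 2 ^ L * 2 ^ ((2 * m + 1) * I + Suc m * j)"
      unfolding power_add[symmetric] by (rule arg_cong[where f="power 2"]) (simp add: I algebra_simps)
    have bin: "real (I choose L) = fact I / (fact L * fact c)"
      using that by (simp add: binomial_fact c_def)
    have "real (2 * I choose (2 * L)) * normal_moment (2 * L) = fact (2 * I) / (2 ^ L * fact L * fact (2 * c))"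
      using binomial_normal_moment[of L "2 * I"] that by (simp add: c_def right_diff_distrib')
    moreover have "2 * I - 2 * L = 2 * c" by (simp add: I)
    moreover have "pochhammer (1/2::real) c \<noteq> 0" "pochhammer (real m + 3/2) c \<noteq> 0"
      by (intro pochhammer_nonzero; simp)+
    ultimately show ?thesis
      unfolding c_def[symmetric] C_def
      by (simp only: me pe pw bin p q) (simp add: divide_simps)
  qed
  then have "?R = (\<Sum>L\<le>I. C * (real (I choose L) * pochhammer (1/2 + real e) L * pochhammer (real m + 1) (I - L)))"
    by simp
  also have "\<dots> = C * pochhammer (real m + 3/2 + real e) I"
    using pochhammer_binomial_sum[of "1/2 + real e" "real m + 1" I]
    by (simp add: sum_distrib_left[symmetric] algebra_simps)
  \<comment> \<open>The sum is \<open>pochhammer (real m + 3/2) (I + e)\<close> divided by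
    \<open>pochhammer (real m + 3/2) e\<close>: the numerator completes the product at t = m + 1,
    and the divisor is the denominator in \<open>minor_moment_odd\<close>.\<close>
  also have "\<dots> = minor_moment_odd (Suc m) I j"
  proof -
    have 1: "fact (2 * I) / fact I = 2 ^ (2 * I) * pochhammer (1/2::real) I"
      using fact_parity[of "2 * I", where 'a = real] by simp
    have 2: "pochhammer (real m + 3/2) (I + e) = pochhammer (real m + 3/2) e * pochhammer (real m + 3/2 + real e) I"
      using pochhammer_product'[of "real m + 3/2" e I] by (simp add: add.commute)
    have 3: "pochhammer (real m + 3/2) e \<noteq> 0" by (intro pochhammer_nonzero) simp
    have 4: "real (Suc m) + 1/2 = real m + 3/2" by simp
    have 5: "(2::real) ^ ((2 * Suc m + 1) * I + Suc m * j) = 2 ^ (2 * I) * 2 ^ ((2 * m + 1) * I + Suc m * j)"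
      unfolding power_add[symmetric] by (rule arg_cong[where f="power 2"]) (simp add: algebra_simps)
    have 6: "(\<Prod>t = 1..Suc m. pochhammer (real t + 1/2) (I + f) * pochhammer (real t + 1/2) (I + e))
      = K * (pochhammer (real m + 3/2) (I + f) * pochhammer (real m + 3/2) (I + e))"
      by (simp add: K_def add.commute)
    show ?thesis
      unfolding minor_moment_odd_def C_def e_def[symmetric] f_def[symmetric]
      unfolding 1 4 5 6 2 using 3 by simp
  qed
  finally show ?thesis by simp
qed

text \<open>Passage from size 2 m + 1 to size 2 m + 2, with \<open>i\<close> of either parity. Here
  the half of the rising factorial based at m + 1/2 cancels the denominator of
  \<open>minor_moment_odd\<close>, and \<open>pochhammer (1/2) h\<close> cancels against
  \<open>fact j\<close>. The Chu-Vandermonde sum produces the final quotient of rising factorials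
  based at m + 3/2 in \<open>minor_moment_even\<close>.\<close>

lemma minor_moment_even_rec:
  "minor_moment_even m i c = (\<Sum>L\<le>i div 2. real (i choose (2 * L)) * normal_moment (2 * L) * (-1) ^ (i - 2 * L) *
      pochhammer (real (2 * m + 1)) (i - 2 * L) * minor_moment_odd m (L + c) (i - 2 * L))" (is "_ = ?R")
proof -
  define e where "e = (i + 1) div 2"
  define f where "f = i div 2"
  define K where "K = (\<Prod>t = 1..m. pochhammer (real t + 1/2) (c + f) * pochhammer (real t + 1/2) (c + e))"
  define C where "C = fact i / fact f * (-1) ^ (Suc m * i) * 2 ^ (m * i + (2 * m + 1) * c)
     * pochhammer (1/2) c * K"
  have "real (i choose (2 * L)) * normal_moment (2 * L) * (-1) ^ (i - 2 * L) *
      pochhammer (real (2 * m + 1)) (i - 2 * L) * minor_moment_odd m (L + c) (i - 2 * L)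
     = C * (real (f choose L) * pochhammer (1/2 + real c) L * pochhammer (real m + 1) (f - L))" if "L \<le> f" for L
  proof -
    define j where "j = i - 2 * L"
    define g where "g = f - L"
    define h where "h = e - L"
    have Le: "L \<le> e" and Li: "2 * L \<le> i" using that by (auto simp: e_def f_def)
    have j2: "j div 2 = g" "(j + 1) div 2 = h"
      using that unfolding j_def g_def h_def e_def f_def by presburger+
    have i: "i = j + 2 * L" and f: "f = L + g" and e: "e = L + h"
      using that Le Li by (auto simp: j_def g_def h_def)
    have p: "pochhammer (real (2 * m + 1)) j = 2 ^ j * pochhammer (real m + 1/2) h * pochhammer (real m + 1) g"
      using pochhammer_parity[of "real m + 1/2" j] unfolding j2 by (simp add: algebra_simps)
    have q: "fact j = 2 ^ j * pochhammer (1/2) h * (fact g :: real)"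
      using fact_parity[of j, where 'a = real] unfolding j2 by simp
    have mo: "minor_moment_odd m (L + c) j = (-1) ^ (m * j) * 2 ^ ((2 * m + 1) * (L + c) + m * j) *
      pochhammer (1/2) (L + c) * K * pochhammer (1/2) h / pochhammer (real m + 1/2) h"
      unfolding minor_moment_odd_def j2 K_def f e by (simp add: ac_simps)
    have pe: "pochhammer (1/2) (L + c) = pochhammer (1/2::real) c * pochhammer (1/2 + real c) L"
      using pochhammer_product'[of "1/2::real" c L] by (simp add: add.commute)
    have sg: "(-1::real) ^ j * (-1) ^ (m * j) = (-1) ^ (Suc m * i)"
      by (simp add: i minus_one_power_iff)
    have bin: "real (f choose L) = fact f / (fact L * fact g)"
      using that by (simp add: binomial_fact g_def)
    have pw2: "(2::real) ^ ((2 * m + 1) * (L + c) + m * j) = 2 ^ L * 2 ^ (m * i + (2 * m + 1) * c)"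
      unfolding power_add[symmetric] by (rule arg_cong[where f="power 2"]) (simp add: i f algebra_simps)
    have cf: "real (i choose (2 * L)) * normal_moment (2 * L) = fact i / (2 ^ L * fact L * fact j)"
      using binomial_normal_moment[of L i] Li by (simp add: j_def)
    have nz: "pochhammer (1/2::real) h \<noteq> 0" "pochhammer (real m + 1/2) h \<noteq> 0"
      by (intro pochhammer_nonzero; simp)+
    have "real (i choose (2 * L)) * normal_moment (2 * L) * (-1) ^ j * pochhammer (real (2 * m + 1)) j * minor_moment_odd m (L + c) j
      = fact i / (2 ^ L * fact L * fact j) * ((-1) ^ j * (-1) ^ (m * j)) * pochhammer (real (2 * m + 1)) j *
        (2 ^ ((2 * m + 1) * (L + c) + m * j) *
      pochhammer (1/2) (L + c) * K * pochhammer (1/2) h / pochhammer (real m + 1/2) h)"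
      unfolding cf mo by simp
    also have "\<dots> = C * (real (f choose L) * pochhammer (1/2 + real c) L * pochhammer (real m + 1) g)"
      unfolding sg pe p q bin pw2 C_def using nz by (simp add: divide_simps)
    finally show ?thesis by (simp only: j_def g_def)
  qed
  then have "?R = (\<Sum>L\<le>f. C * (real (f choose L) * pochhammer (1/2 + real c) L * pochhammer (real m + 1) (f - L)))"
    by (simp add: f_def)
  also have "\<dots> = C * pochhammer (real m + 3/2 + real c) f"
    using pochhammer_binomial_sum[of "1/2 + real c" "real m + 1" f]
    by (simp add: sum_distrib_left[symmetric] algebra_simps)
  also have "\<dots> = minor_moment_even m i c"
  proof -
    have 1: "fact i / fact f = 2 ^ i * pochhammer (1/2::real) e"
      using fact_parity[of i, where 'a = real] by (simp add: e_def f_def)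
    have 2: "pochhammer (real m + 3/2) (c + f) = pochhammer (real m + 3/2) c * pochhammer (real m + 3/2 + real c) f"
      using pochhammer_product'[of "real m + 3/2" c f] by simp
    have 3: "pochhammer (real m + 3/2) c \<noteq> 0" by (intro pochhammer_nonzero) simp
    have 4: "(2::real) ^ (Suc m * i + (2 * m + 1) * c) = 2 ^ i * 2 ^ (m * i + (2 * m + 1) * c)"
      unfolding power_add[symmetric] by (rule arg_cong[where f="power 2"]) (simp add: algebra_simps)
    show ?thesis
      unfolding minor_moment_even_def C_def e_def[symmetric] f_def[symmetric] K_def[symmetric]
      unfolding 1 2 4 using 3 by simp
  qed
  finally show ?thesis by simp
qed

text \<open>Odd normal moments vanish, so l = 2 L. Then i - 2 L has the parity of i and 2 L + j that
  of j, so in a vanishing branch on the left every summand on the right vanishes too.\<close>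

lemma minor_moment_rec:
  assumes "n \<ge> 1"
  shows "minor_moment (Suc n) i j = (\<Sum>l\<le>i. real (i choose l) * normal_moment l * (-1) ^ (i - l) *
     pochhammer (real n) (i - l) * minor_moment n (l + j) (i - l))" (is "_ = (\<Sum>l\<le>i. ?g l)")
proof -
  have sum: "(\<Sum>l\<le>i. ?g l) = (\<Sum>L\<le>i div 2. ?g (2 * L))"
    by (rule sum_even_indices) (simp add: normal_moment_def)
  show ?thesis
  proof (cases "even n")
    case True
    then obtain m where n: "n = 2 * m + 2"
      using assms by (metis One_nat_def dvd_def mult_2 not0_implies_Suc add_Suc_right add_Suc mult_Suc_right mult_zero_right not_one_le_zero add.commute)
    show ?thesis
    proof (cases "even i")
      case True
      then obtain I where i: "i = 2 * I" by blast
      have "minor_moment (Suc n) i j = minor_moment_odd (Suc m) I j" by (simp add: minor_moment_def n i)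
      also have "\<dots> = (\<Sum>L\<le>i div 2. ?g (2 * L))"
        unfolding minor_moment_odd_rec
        by (rule sum.cong) (auto simp: minor_moment_def n i simp flip: right_diff_distrib')
      finally show ?thesis using sum by simp
    next
      case False
      then have "(\<Sum>L\<le>i div 2. ?g (2 * L)) = 0"
        by (intro sum.neutral) (auto simp: minor_moment_def n)
      then show ?thesis
        using False unfolding sum by (simp add: n minor_moment_def)
    qed
  next
    case False
    then obtain m where n: "n = 2 * m + 1" by (blast elim: oddE)
    show ?thesis
    proof (cases "even j")
      case True
      then obtain c where j: "j = 2 * c" by blast
      have "minor_moment (Suc n) i j = minor_moment_even m i c" by (simp add: minor_moment_def n j)
      also have "\<dots> = (\<Sum>L\<le>i div 2. ?g (2 * L))"
        unfolding minor_moment_even_rec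
        by (rule sum.cong) (auto simp: minor_moment_def n j)
      finally show ?thesis using sum by simp
    next
      case False
      then have "(\<Sum>L\<le>i div 2. ?g (2 * L)) = 0"
        by (intro sum.neutral) (auto simp: minor_moment_def n)
      then show ?thesis
        using False unfolding sum by (simp add: n minor_moment_def)
    qed
  qed
qed

text \<open>Base of the induction: d_1 is one standard normal variable and d_0 is 1, so the value is
  the same for every \<open>j\<close>.\<close>

lemma minor_moment_1: "minor_moment 1 i j = normal_moment i"
proof (cases "even i")
  case True
  then obtain I where i: "i = 2 * I" by blast
  have "pochhammer (1/2::real) ((j + 1) div 2) \<noteq> 0" by (intro pochhammer_nonzero) simp
  moreover have "(fact (2 * I) :: real) = 2 ^ (2 * I) * pochhammer (1/2) I * fact I"
    using fact_parity[of "2 * I", where 'a = real] by simp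
  ultimately show ?thesis
    by (simp add: minor_moment_def minor_moment_odd_def normal_moment_def i power_mult power_mult_distrib[symmetric] divide_simps)
qed (simp add: minor_moment_def normal_moment_def)

section \<open>The closed form as the two double products\<close>

lemma prod_pochhammer_half:
  "(\<Prod>j\<in>{1..q}. 2 * real a + 2 * real j - 1) = 2 ^ q * pochhammer (real a + 1/2) q"
  by (induction q) (simp_all add: pochhammer_Suc algebra_simps)

text \<open>As i grows from 1, \<open>i div 2\<close> runs through 0, 1, 1, 2, 2, and so on: the
  indices i = 2 t + 1 give the first product, the indices i = 2 t + 2 the second.\<close>

lemma prod_halves:
  fixes g :: "nat \<Rightarrow> 'a::comm_monoid_mult"
  shows "(\<Prod>i\<in>{1..k}. g (i div 2)) = (\<Prod>t<(k + 1) div 2. g t) * (\<Prod>t<k div 2. g (Suc t))"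
proof (induction k)
  case (Suc k)
  then show ?case by (cases "even k") (auto elim!: evenE oddE simp: ac_simps)
qed simp

text \<open>For even exponent the two factors at each t in the closed form coincide, matching the
  two indices with \<open>i div 2 = t\<close>. The unpaired value 0, and for even n also the last
  value m + 1, give the separate factors.\<close>

lemma minor_moment_even_power:
  assumes "n \<ge> 1"
  shows "minor_moment n (2 * q) 0 = (\<Prod>i\<in>{1..n}. \<Prod>j\<in>{1..q}. 2 * real (i div 2) + 2 * real j - 1)"
proof -
  define G where "G = (\<lambda>a. 2 ^ q * pochhammer (real a + 1/2) q)"
  have shift: "(\<Prod>t = 1..m. f t) = (\<Prod>t<m. f (Suc t))" for f :: "nat \<Rightarrow> real" and m
    by (rule prod.reindex_bij_witness[of _ Suc "\<lambda>t. t - 1"]) auto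
  have R: "(\<Prod>i\<in>{1..n}. \<Prod>j\<in>{1..q}. 2 * real (i div 2) + 2 * real j - 1)
     = (\<Prod>t<(n + 1) div 2. G t) * (\<Prod>t<n div 2. G (Suc t))"
    unfolding prod_pochhammer_half G_def[symmetric]
    using prod_halves[of "\<lambda>a. 2 ^ q * pochhammer (real a + 1/2) q" n] by (simp add: G_def)
  define K where "K = (\<lambda>m. \<Prod>t = 1..m. pochhammer (real t + 1/2) q)"
  have K: "(\<Prod>t<m. G (Suc t)) = (2 ^ q) ^ m * K m" for m
    unfolding K_def shift by (simp add: G_def prod.distrib)
  have KK: "(\<Prod>t = 1..m. pochhammer (real t + 1/2) q * pochhammer (real t + 1/2) q) = K m * K m" for m
    by (simp add: K_def prod.distrib)
  show ?thesis
  proof (cases "even n")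
    case True
    then obtain m where n: "n = 2 * m + 2"
      using assms by (metis One_nat_def add_2_eq_Suc' dvd_def mult_2 nat.exhaust not_one_le_zero mult_Suc_right mult_zero_right add.commute)
    have "(\<Prod>t<Suc m. G t) = G 0 * (\<Prod>t<m. G (Suc t))" "(\<Prod>t<Suc m. G (Suc t)) = (\<Prod>t<m. G (Suc t)) * G (Suc m)"
      by (rule prod.lessThan_Suc_shift, simp)
    moreover have "(2 * m + 2 + 1) div 2 = Suc m" "(2 * m + 2) div 2 = Suc m" by simp_all
    moreover have "(2::real) ^ (Suc m * (2 * q)) = 2 ^ q * 2 ^ q * ((2 ^ q) ^ m * (2 ^ q) ^ m)"
      unfolding power_mult[symmetric] power_add[symmetric]
      by (rule arg_cong[where f = "power 2"]) (simp add: algebra_simps)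
    moreover have "minor_moment n (2 * q) 0 = 2 ^ (Suc m * (2 * q)) * pochhammer (1/2) q * (K m * K m) * pochhammer (real m + 3/2) q"
      using KK[of m] by (simp add: minor_moment_def minor_moment_even_def n)
    ultimately show ?thesis
      unfolding R unfolding n K by (simp add: G_def add.commute)
  next
    case False
    then obtain m where n: "n = 2 * m + 1" by (blast elim: oddE)
    have "(\<Prod>t<Suc m. G t) = G 0 * (\<Prod>t<m. G (Suc t))"
      by (simp add: prod.lessThan_Suc_shift del: prod.lessThan_Suc)
    moreover have "(2 * m + 1 + 1) div 2 = Suc m" "(2 * m + 1) div 2 = m" by simp_all
    moreover have "(2::real) ^ ((2 * m + 1) * q) = 2 ^ q * ((2 ^ q) ^ m * (2 ^ q) ^ m)"
      unfolding power_mult[symmetric] power_add[symmetric]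
      by (rule arg_cong[where f = "power 2"]) (simp add: algebra_simps)
    moreover have "minor_moment n (2 * q) 0 = 2 ^ ((2 * m + 1) * q) * pochhammer (1/2) q * (K m * K m)"
      using KK[of m] by (simp add: minor_moment_def minor_moment_odd_def n)
    ultimately show ?thesis
      unfolding R unfolding n K by (simp add: G_def)
  qed
qed

text \<open>Now the product over i is taken first: for fixed j it is a pair of rising factorials of
  lengths \<open>e\<close> and \<open>f\<close>, the two halves of k. The index j takes the part of
  t; in the first family j = 1 splits off as \<open>pochhammer (1/2) e\<close> and the rest shifts
  by one.\<close>

lemma minor_moment_even_size:
  assumes "p \<ge> 1"
  shows "minor_moment (2 * p) k 0 = (-1) ^ (p * k) * (\<Prod>i\<in>{1..k}. \<Prod>j\<in>{1..p}. 2 * real (i div 2) + 2 * real j - 1)"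
proof -
  obtain m where p: "p = Suc m" using assms by (cases p) auto
  define e where "e = (k + 1) div 2"
  define f where "f = k div 2"
  have "Suc k div 2 = e" by (simp add: e_def)
  have k: "k = e + f" unfolding e_def f_def by presburger
  have inner: "(\<Prod>i\<in>{1..k}. 2 * real (i div 2) + 2 * real j - 1)
     = 2 ^ k * (pochhammer (real j - 1/2) e * pochhammer (real j + 1/2) f)" for j
  proof -
    have "(\<Prod>t<l. 2 * real t + 2 * x - 1) = 2 ^ l * pochhammer (x - 1/2) l" for l x
      by (induction l) (simp_all add: pochhammer_Suc algebra_simps)
    note * = this
    have "(\<Prod>i\<in>{1..k}. 2 * real (i div 2) + 2 * real j - 1)
      = (\<Prod>t<e. 2 * real t + 2 * real j - 1) * (\<Prod>t<f. 2 * real (Suc t) + 2 * real j - 1)"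
      unfolding e_def f_def by (rule prod_halves)
    also have "(\<Prod>t<f. 2 * real (Suc t) + 2 * real j - 1) = (\<Prod>t<f. 2 * real t + 2 * (real j + 1) - 1)"
      by (simp add: algebra_simps)
    finally show ?thesis unfolding * by (simp add: k power_add add.commute[of _ "1/2"])
  qed
  have P1: "(\<Prod>j\<in>{1..Suc m}. pochhammer (real j - 1/2) e) = pochhammer (1/2) e * (\<Prod>t\<in>{1..m}. pochhammer (real t + 1/2) e)"
    by (induction m) simp_all
  have P2: "(\<Prod>j\<in>{1..Suc m}. pochhammer (real j + 1/2) f) = (\<Prod>t\<in>{1..m}. pochhammer (real t + 1/2) f) * pochhammer (real m + 3/2) f"
    by (simp add: add.commute)
  have "(\<Prod>i\<in>{1..k}. \<Prod>j\<in>{1..p}. 2 * real (i div 2) + 2 * real j - 1)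
     = (\<Prod>j\<in>{1..p}. \<Prod>i\<in>{1..k}. 2 * real (i div 2) + 2 * real j - 1)"
    by (rule prod.swap)
  also have "\<dots> = 2 ^ (k * p) * ((\<Prod>j\<in>{1..p}. pochhammer (real j - 1/2) e) * (\<Prod>j\<in>{1..p}. pochhammer (real j + 1/2) f))"
    unfolding inner by (simp add: prod.distrib power_mult)
  also have "\<dots> = 2 ^ (k * p) * (pochhammer (1/2) e * (\<Prod>t\<in>{1..m}. pochhammer (real t + 1/2) e)
     * ((\<Prod>t\<in>{1..m}. pochhammer (real t + 1/2) f) * pochhammer (real m + 3/2) f))"
    unfolding p P1 P2 ..
  finally show ?thesis
    using \<open>Suc k div 2 = e\<close> by (simp add: minor_moment_def minor_moment_even_def p prod.distrib mult_ac flip: f_def)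
qed

section \<open>Orthogonal invariance of the Ginibre ensemble\<close>

lemma nn_integral_lborel_translate:
  fixes f :: "'a::euclidean_space \<Rightarrow> ennreal"
  assumes [measurable]: "f \<in> borel_measurable borel"
  shows "(\<integral>\<^sup>+x. f (x + t) \<partial>lborel) = (\<integral>\<^sup>+x. f x \<partial>lborel)"
proof -
  have "(\<integral>\<^sup>+x. f x \<partial>lborel) = (\<integral>\<^sup>+x. f x \<partial>distr lborel borel ((+) t))"
    by (simp add: lborel_distr_plus)
  also have "\<dots> = (\<integral>\<^sup>+x. f (x + t) \<partial>lborel)"
    by (subst nn_integral_distr) (auto simp: add.commute)
  finally show ?thesis by simp
qed

lemma nn_integral_lborel_orthogonal:
  fixes T :: "'a::euclidean_space \<Rightarrow> 'a"
  assumes T: "orthogonal_transformation T"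
    and [measurable]: "F \<in> borel_measurable borel"
  shows "(\<integral>\<^sup>+x. F (T x) \<partial>lborel) = (\<integral>\<^sup>+x. F x \<partial>lborel)"
proof -
  \<comment> \<open>A rotation-invariant weight in a second variable: two translations and Fubini then remove the rotation.\<close>
  define k :: "'a \<Rightarrow> ennreal" where "k = indicator (ball 0 1)"
  define K where "K = (\<integral>\<^sup>+x. k x \<partial>lborel)"
  have lin: "linear T" using T by (rule orthogonal_transformation_linear)
  have [measurable]: "T \<in> borel_measurable borel"
    by (intro borel_measurable_continuous_onI linear_continuous_on linear_linear[THEN iffD2] lin)
  have [measurable]: "k \<in> borel_measurable borel"
    unfolding k_def by (intro borel_measurable_indicator borel_open open_ball)
  have surj: "T (inv T y) = y" for y
    using orthogonal_transformation_surj[OF T] by (simp add: surj_f_inv_f)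
  \<comment> \<open>The weight has positive finite mass, which permits its cancellation in
    \<open>ennreal\<close> at the end.\<close>
  have "K = emeasure lborel (ball (0::'a) 1)" unfolding K_def k_def by simp
  moreover have "emeasure lborel (ball (0::'a) 1) \<noteq> 0"
    using content_ball_pos[of 1 "0::'a"] by (auto simp: measure_def)
  moreover have "emeasure lborel (ball (0::'a) 1) \<noteq> \<infinity>"
    using emeasure_bounded_finite[OF bounded_ball[of "0::'a" 1]] by simp
  ultimately have K: "K \<noteq> 0" "K \<noteq> \<infinity>" by auto
  have "K * (\<integral>\<^sup>+x. F (T x) \<partial>lborel) = (\<integral>\<^sup>+x. (\<integral>\<^sup>+y. F (T x) * k y \<partial>lborel) \<partial>lborel)"
    by (simp add: nn_integral_cmult nn_integral_multc K_def mult.commute)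
  also have "\<dots> = (\<integral>\<^sup>+x. (\<integral>\<^sup>+y. F (T x) * k (y - T x) \<partial>lborel) \<partial>lborel)"
    using nn_integral_lborel_translate[of "\<lambda>y. F (T x) * k y" "- T x" for x] by simp
  also have "\<dots> = (\<integral>\<^sup>+y. (\<integral>\<^sup>+x. F (T x) * k (y - T x) \<partial>lborel) \<partial>lborel)"
    by (intro lborel_pair.Fubini') measurable
  also have "\<dots> = (\<integral>\<^sup>+y. (\<integral>\<^sup>+x. F (T x + y) * k x \<partial>lborel) \<partial>lborel)"
  proof (rule nn_integral_cong)
    fix y
    \<comment> \<open>Translating x by \<open>inv T y\<close> turns \<open>y - T x\<close> into
      \<open>- T x\<close>; the ball is invariant under negation and under \<open>T\<close>, so the
      rotation disappears from the weight.\<close>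
    have "k (- T x) = k x" for x
      by (simp add: k_def indicator_def orthogonal_transformation_norm[OF T])
    then show "(\<integral>\<^sup>+x. F (T x) * k (y - T x) \<partial>lborel) = (\<integral>\<^sup>+x. F (T x + y) * k x \<partial>lborel)"
      using nn_integral_lborel_translate[of "\<lambda>x. F (T x) * k (y - T x)" "inv T y"]
      by (simp add: linear_add[OF lin] surj)
  qed
  also have "\<dots> = (\<integral>\<^sup>+x. (\<integral>\<^sup>+y. F (T x + y) * k x \<partial>lborel) \<partial>lborel)"
    by (intro lborel_pair.Fubini') measurable
  also have "\<dots> = (\<integral>\<^sup>+x. (\<integral>\<^sup>+y. F y * k x \<partial>lborel) \<partial>lborel)"
    using nn_integral_lborel_translate[of "\<lambda>y. F y * k x" "T x" for x] by (simp add: add.commute)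
  also have "\<dots> = K * (\<integral>\<^sup>+x. F x \<partial>lborel)"
    by (simp add: nn_integral_cmult nn_integral_multc K_def mult.commute)
  finally show ?thesis
    using K by (simp add: ennreal_mult_cancel_left)
qed

section \<open>The Gaussian density on matrix space\<close>

lemma norm_entry_matrix_sq:
  "norm (entry_matrix x) ^ 2 = (\<Sum>c\<in>UNIV. (x c)\<^sup>2)" for x :: "'n::finite \<times> 'n \<times> bool \<Rightarrow> real"
proof -
  have "norm (entry_matrix x) ^ 2 = (\<Sum>i\<in>UNIV. \<Sum>j\<in>UNIV. (x (i, j, False))\<^sup>2 + (x (i, j, True))\<^sup>2)"
    unfolding power2_norm_eq_inner
    by (simp add: inner_vec_def inner_complex_def entry_matrix_def power2_eq_square)
  also have "\<dots> = (\<Sum>i\<in>UNIV. \<Sum>j\<in>UNIV. \<Sum>t\<in>UNIV. (x (i, j, t))\<^sup>2)"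
    by (simp add: UNIV_bool add.commute)
  also have "\<dots> = (\<Sum>c\<in>UNIV. (x c)\<^sup>2)"
    by (simp add: sum.cartesian_product case_prod_unfold)
  finally show ?thesis .
qed

text \<open>Indexes the real \<open>Basis\<close> of the matrix space by the coordinates of
  \<open>entry_space\<close>, so that the two product structures can be compared factor by
  factor.\<close>

definition entry_basis :: "'n::finite \<times> 'n \<times> bool \<Rightarrow> complex ^ 'n ^ 'n" where
  "entry_basis = (\<lambda>(i, j, t). axis i (axis j (if t then \<i> else 1)))"

lemma bij_betw_entry_basis:
  "bij_betw (entry_basis :: 'n::finite \<times> 'n \<times> bool \<Rightarrow> complex ^ 'n ^ 'n) UNIV Basis"
  unfolding bij_betw_def
proof
  show "inj (entry_basis :: 'n \<times> 'n \<times> bool \<Rightarrow> complex ^ 'n ^ 'n)"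
    by (auto simp: inj_on_def entry_basis_def axis_eq_axis split: if_splits)
  show "range (entry_basis :: 'n \<times> 'n \<times> bool \<Rightarrow> complex ^ 'n ^ 'n) = Basis"
  proof (intro equalityI subsetI)
    fix b :: "complex ^ 'n ^ 'n" assume "b \<in> Basis"
    then obtain i j u where "b = axis i (axis j u)" "u = 1 \<or> u = \<i>"
      by (auto simp: Basis_vec_def Basis_complex_def)
    then have "b = entry_basis (i, j, u = \<i>)"
      by (auto simp: entry_basis_def)
    then show "b \<in> range entry_basis" by blast
  next
    fix b :: "complex ^ 'n ^ 'n" assume "b \<in> range entry_basis"
    then obtain i j t where "b = entry_basis (i, j, t)" by auto
    then show "b \<in> Basis"
      by (cases t) (fastforce simp: entry_basis_def Basis_vec_def Basis_complex_def)+
  qed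
qed

lemma entry_matrix_inner_basis: "entry_matrix x \<bullet> entry_basis c = x c"
  by (cases c) (auto simp: entry_matrix_def entry_basis_def inner_axis inner_complex_def)

lemma sets_PiM_lborel: "sets (PiM UNIV (\<lambda>_::'n::finite \<times> 'n \<times> bool. lborel :: real measure)) = sets entry_space"
  unfolding entry_space_def by (intro sets_PiM_cong) (auto simp: std_normal_def)

lemma measurable_entry_matrix[measurable]:
  "entry_matrix \<in> borel_measurable entry_space"
  "entry_matrix \<in> borel_measurable (PiM UNIV (\<lambda>_. lborel))"
  using borel_measurable_entry_matrix measurable_cong_sets[OF sets_PiM_lborel refl] by auto

text \<open>Lebesgue measure is determined by the volumes of boxes, and a box pulls back to a
  product of intervals, one for each coordinate.\<close>

lemma distr_entry_matrix_lborel: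
  "distr (PiM UNIV (\<lambda>_::'n::finite \<times> 'n \<times> bool. lborel)) borel entry_matrix = lborel"
proof (rule lborel_eqI[symmetric])
  interpret finite_product_sigma_finite "\<lambda>_::'n \<times> 'n \<times> bool. lborel :: real measure" UNIV
    by standard simp
  fix l u :: "complex ^ 'n ^ 'n"
  assume le: "\<And>b. b \<in> Basis \<Longrightarrow> l \<bullet> b \<le> u \<bullet> b"
  have "entry_matrix -` box l u \<inter> space (PiM UNIV (\<lambda>_::'n \<times> 'n \<times> bool. lborel))
     = (\<Pi>\<^sub>E c\<in>UNIV. {l \<bullet> entry_basis c <..< u \<bullet> entry_basis c})"
  proof (intro set_eqI)
    fix x :: "'n \<times> 'n \<times> bool \<Rightarrow> real"
    have "entry_matrix x \<in> box l u \<longleftrightarrow> (\<forall>c. l \<bullet> entry_basis c < x c \<and> x c < u \<bullet> entry_basis c)"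
      by (simp add: box_def bij_betw_imp_surj_on[OF bij_betw_entry_basis, symmetric] entry_matrix_inner_basis)
    then show "x \<in> entry_matrix -` box l u \<inter> space (PiM UNIV (\<lambda>_::'n \<times> 'n \<times> bool. lborel)) \<longleftrightarrow>
        x \<in> (\<Pi>\<^sub>E c\<in>UNIV. {l \<bullet> entry_basis c <..< u \<bullet> entry_basis c})"
      by (auto simp: space_PiM PiE_def)
  qed
  then have "emeasure (distr (PiM UNIV (\<lambda>_::'n \<times> 'n \<times> bool. lborel)) borel entry_matrix) (box l u)
     = (\<Prod>c\<in>UNIV. emeasure lborel {l \<bullet> entry_basis c <..< u \<bullet> entry_basis c})"
    by (simp add: emeasure_distr measure_times)
  also have "\<dots> = (\<Prod>c\<in>UNIV. ennreal ((u - l) \<bullet> entry_basis c))"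
    using le bij_betw_entry_basis[where 'n = 'n] 
    by (intro prod.cong refl) (auto simp: inner_diff_left bij_betw_def intro!: emeasure_lborel_Ioo)
  also have "\<dots> = (\<Prod>b\<in>Basis. ennreal ((u - l) \<bullet> b))"
    by (rule prod.reindex_bij_betw[OF bij_betw_entry_basis])
  also have "\<dots> = ennreal (\<Prod>b\<in>Basis. (u - l) \<bullet> b)"
    using le by (intro prod_ennreal) (simp add: inner_diff_left)
  finally show "emeasure (distr (PiM UNIV (\<lambda>_::'n \<times> 'n \<times> bool. lborel)) borel entry_matrix) (box l u)
     = ennreal (\<Prod>b\<in>Basis. (u - l) \<bullet> b)" .
qed simp

text \<open>Both measures are compared on rectangles, where density and indicator split into one
  factor per coordinate and the integral of the product is the product of the integrals.\<close>

lemma entry_space_density: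
  "entry_space = density (PiM UNIV (\<lambda>_::'n::finite \<times> 'n \<times> bool. lborel))
      (\<lambda>x. \<Prod>c\<in>UNIV. ennreal (std_normal_density (x c)))"
proof -
  interpret L: product_sigma_finite "\<lambda>_::'n \<times> 'n \<times> bool. lborel :: real measure" by standard
  interpret N: prob_space std_normal
    unfolding std_normal_def by (rule prob_space_normal_density) simp
  interpret N: product_prob_space "\<lambda>_::'n \<times> 'n \<times> bool. std_normal" by standard
  show ?thesis
    unfolding entry_space_def
  proof (rule N.PiM_eqI[symmetric])
    fix A :: "'n \<times> 'n \<times> bool \<Rightarrow> real set"
    assume "\<And>i. i \<in> UNIV \<Longrightarrow> A i \<in> sets std_normal"
    then have [measurable]: "A i \<in> sets borel" for i by (simp add: std_normal_def)
    have "emeasure (density (PiM UNIV (\<lambda>_::'n \<times> 'n \<times> bool. lborel))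
        (\<lambda>x. \<Prod>c\<in>UNIV. ennreal (std_normal_density (x c)))) (Pi\<^sub>E UNIV A)
      = (\<integral>\<^sup>+x. (\<Prod>c\<in>UNIV. ennreal (std_normal_density (x c))) * indicator (Pi\<^sub>E UNIV A) x
          \<partial>PiM UNIV (\<lambda>_. lborel))"
      by (subst emeasure_density) (auto intro!: sets_PiM_I_finite)
    also have "\<dots> = (\<integral>\<^sup>+x. (\<Prod>c\<in>UNIV. ennreal (std_normal_density (x c)) * indicator (A c) (x c))
          \<partial>PiM UNIV (\<lambda>_. lborel))"
      
    proof (intro nn_integral_cong)
      fix x :: "'n \<times> 'n \<times> bool \<Rightarrow> real"
      have "(\<Prod>c\<in>UNIV. indicator (A c) (x c) :: ennreal) = indicator (Pi\<^sub>E UNIV A) x"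
      proof (cases "\<forall>c. x c \<in> A c")
        case False
        then obtain c where c: "x c \<notin> A c" by blast
        then have "(\<Prod>c\<in>UNIV. indicator (A c) (x c) :: ennreal) = 0"
          by (intro prod_zero bexI[of _ c]) auto
        moreover have "x \<notin> Pi\<^sub>E UNIV A" using c by (metis PiE_mem UNIV_I)
        ultimately show ?thesis by (simp only: indicator_simps not_False_eq_True)
      next
        case True
        then have "(\<Prod>c\<in>UNIV. indicator (A c) (x c) :: ennreal) = 1"
          by (intro prod.neutral ballI indicator_simps(1)) blast
        moreover have "x \<in> Pi\<^sub>E UNIV A" using True by (simp only: PiE_UNIV_domain Pi_iff) blast
        ultimately show ?thesis by (simp only: indicator_simps)
      qed
      then show "(\<Prod>c\<in>UNIV. ennreal (std_normal_density (x c))) * indicator (Pi\<^sub>E UNIV A) x =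
          (\<Prod>c\<in>UNIV. ennreal (std_normal_density (x c)) * indicator (A c) (x c))"
        by (simp add: prod.distrib)
    qed
    also have "\<dots> = (\<Prod>c\<in>UNIV. emeasure std_normal (A c))"
      by (subst L.product_nn_integral_prod) (auto simp: std_normal_def emeasure_density)
    finally show "emeasure (density (PiM UNIV (\<lambda>_::'n \<times> 'n \<times> bool. lborel))
        (\<lambda>x. \<Prod>c\<in>UNIV. ennreal (std_normal_density (x c)))) (Pi\<^sub>E UNIV A)
      = (\<Prod>c\<in>UNIV. emeasure std_normal (A c))" .
  qed (simp_all add: sets_PiM_lborel entry_space_def)
qed

text \<open>The exponents of the coordinate densities add up to the squared norm of the matrix, so
  the density is radial, which is the form that rotation invariance uses.\<close>

lemma ginibre_density:
  "\<exists>g. g \<in> borel_measurable borel \<and>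
     (ginibre :: (complex ^ 'n ^ 'n::finite) measure) = density lborel (\<lambda>G. g (norm G))"
proof (intro exI conjI)
  define g :: "real \<Rightarrow> ennreal" where
    "g r = ennreal ((1 / sqrt (2 * pi)) ^ CARD('n \<times> 'n \<times> bool) * exp (- r\<^sup>2 / 2))" for r
  show g[measurable]: "g \<in> borel_measurable borel" unfolding g_def by measurable
  have eq: "(\<Prod>c\<in>UNIV. ennreal (std_normal_density (x c))) = g (norm (entry_matrix x))"
    for x :: "'n \<times> 'n \<times> bool \<Rightarrow> real"
  proof -
    have "(\<Prod>c\<in>UNIV. std_normal_density (x c)) =
       (1 / sqrt (2 * pi)) ^ CARD('n \<times> 'n \<times> bool) * exp (\<Sum>c\<in>UNIV. - (x c)\<^sup>2 / 2)"
      unfolding std_normal_density_def prod.distrib prod_constant exp_sum[OF finite] ..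
    then show ?thesis
      unfolding g_def norm_entry_matrix_sq
      by (subst prod_ennreal) (auto simp: sum_negf sum_divide_distrib)
  qed
  show "(ginibre :: (complex ^ 'n ^ 'n::finite) measure) = density lborel (\<lambda>G. g (norm G))"
    unfolding ginibre_def entry_space_density eq
    by (subst density_distr[symmetric]) (simp_all add: distr_entry_matrix_lborel)
qed

lemma distr_ginibre_orthogonal:
  fixes T :: "complex ^ 'n ^ 'n::finite \<Rightarrow> complex ^ 'n ^ 'n"
  assumes T: "orthogonal_transformation T"
  shows "distr ginibre borel T = ginibre"
proof -
  obtain g where [measurable]: "g \<in> borel_measurable borel"
    and g: "(ginibre :: (complex ^ 'n ^ 'n) measure) = density lborel (\<lambda>G. g (norm G))"
    using ginibre_density[where 'n = 'n] by blast
  have [measurable]: "T \<in> borel_measurable borel"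
    by (intro borel_measurable_continuous_onI linear_continuous_on linear_linear[THEN iffD2]
        orthogonal_transformation_linear T)
  show ?thesis
  proof (rule measure_eqI)
    fix A assume "A \<in> sets (distr ginibre borel T)"
    then have [measurable]: "A \<in> sets borel" by simp
    have "emeasure (distr ginibre borel T) A = (\<integral>\<^sup>+x. g (norm x) * indicator A (T x) \<partial>lborel)"
      unfolding g by (simp add: emeasure_distr emeasure_density indicator_vimage[symmetric] vimage_def
        measurable_sets_borel indicator_def)
    also have "\<dots> = (\<integral>\<^sup>+x. g (norm x) * indicator A x \<partial>lborel)"
      using nn_integral_lborel_orthogonal[OF T, of "\<lambda>x. g (norm x) * indicator A x"]
      by (simp add: orthogonal_transformation_norm[OF T])
    also have "\<dots> = emeasure ginibre A"
      unfolding g by (simp add: emeasure_density)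
    finally show "emeasure (distr ginibre borel T) A = emeasure ginibre A" .
  qed (simp add: g)
qed

section \<open>Bordered determinants and unitary reflections\<close>

definition proj :: "'n set \<Rightarrow> complex ^ 'n ^ 'n" where
  "proj S = (\<chi> i j. if i = j \<and> i \<in> S then 1 else 0)"

definition block :: "'n set \<Rightarrow> complex ^ 'n ^ 'n \<Rightarrow> complex ^ 'n ^ 'n" where
  "block S H = (\<chi> i j. if i \<in> S \<and> j \<in> S then H $ i $ j else 0)"

definition outer :: "complex ^ 'n \<Rightarrow> complex ^ 'n \<Rightarrow> complex ^ 'n ^ 'n" where
  "outer u v = (\<chi> i j. u $ i * v $ j)"

definition cnj_vec :: "complex ^ 'n \<Rightarrow> complex ^ 'n" where
  "cnj_vec v = (\<chi> i. cnj (v $ i))"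

text \<open>Identity padding outside \<open>S\<close> lets minors of all sizes live on one matrix
  type; the minor on the empty set is then 1.\<close>

definition minor_det :: "'n::finite set \<Rightarrow> complex ^ 'n ^ 'n \<Rightarrow> complex" where
  "minor_det S H = det (block S H + proj (- S))"

text \<open>The border \<open>b\<close> is a separate argument and not read off from
  \<open>H\<close>, so that it can be frozen while \<open>H\<close> is averaged. If \<open>b\<close>
  vanishes at \<open>r\<close>, the corner entry is 0.\<close>

definition bordered_det :: "'n::finite set \<Rightarrow> 'n \<Rightarrow> complex ^ 'n \<Rightarrow> complex ^ 'n ^ 'n \<Rightarrow> complex" where
  "bordered_det S r b H = det (block S H + outer b (axis r 1) + outer (axis r 1) (cnj_vec b)
     + proj (- insert r S))"

section \<open>Splitting off a diagonal entry\<close>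

text \<open>In the Leibniz sum the permutations fixing \<open>r\<close> give the first term; the
  others never meet the entry at (r, r), which may therefore be replaced by 0.\<close>

lemma det_split_entry:
  fixes A :: "'a::comm_ring_1 ^ 'n ^ 'n::finite"
  shows "det A = A $ r $ r * det (\<chi> i j. if i = r \<or> j = r then of_bool (i = j) else A $ i $ j)
     + det (\<chi> i j. if i = r \<and> j = r then 0 else A $ i $ j)"
proof -
  define B :: "'a ^ 'n ^ 'n" where "B = (\<chi> i j. if i = r \<or> j = r then of_bool (i = j) else A $ i $ j)"
  define C :: "'a ^ 'n ^ 'n" where "C = (\<chi> i j. if i = r \<and> j = r then 0 else A $ i $ j)"
  have "(\<Prod>i\<in>UNIV. A $ i $ p i) = A $ r $ r * (\<Prod>i\<in>UNIV. B $ i $ p i) + (\<Prod>i\<in>UNIV. C $ i $ p i)"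
    if p: "p permutes UNIV" for p
  proof (cases "p r = r")
    case True
    have "p i \<noteq> r" if "i \<noteq> r" for i
      using True that permutes_inj[OF p] by (metis injD)
    then have "(\<Prod>i\<in>UNIV - {r}. B $ i $ p i) = (\<Prod>i\<in>UNIV - {r}. A $ i $ p i)"
      by (intro prod.cong) (auto simp: B_def)
    moreover have "(\<Prod>i\<in>UNIV. C $ i $ p i) = 0"
      by (intro prod_zero bexI[of _ r]) (auto simp: C_def True)
    ultimately show ?thesis
      by (simp add: prod.remove[of UNIV r] True B_def)
  next
    case False
    then have "(\<Prod>i\<in>UNIV. B $ i $ p i) = 0"
      by (intro prod_zero bexI[of _ r]) (auto simp: B_def)
    moreover have "(\<Prod>i\<in>UNIV. C $ i $ p i) = (\<Prod>i\<in>UNIV. A $ i $ p i)"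
      using False by (intro prod.cong) (auto simp: C_def)
    ultimately show ?thesis by simp
  qed
  then show ?thesis
    unfolding B_def[symmetric] C_def[symmetric] det_def
    by (simp add: sum_distrib_left sum.distrib[symmetric] distrib_left mult.left_commute)
qed

lemma det_pivot_row:
  fixes A :: "'a::field ^ 'n ^ 'n::finite"
  assumes "\<And>j. j \<noteq> r \<Longrightarrow> A $ r $ j = 0"
  shows "det A = A $ r $ r * det (\<chi> i j. if i = r \<or> j = r then of_bool (i = j) else A $ i $ j)"
proof -
  have "row r (\<chi> i j. if i = r \<and> j = r then 0 else A $ i $ j) = 0"
    using assms by (auto simp: row_def vec_eq_iff)
  then show ?thesis
    by (subst det_split_entry[of A r]) (simp add: det_zero_row(2))
qed

lemma det_pivot_column:
  fixes A :: "'a::field ^ 'n ^ 'n::finite"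
  assumes "\<And>i. i \<noteq> r \<Longrightarrow> A $ i $ r = 0"
  shows "det A = A $ r $ r * det (\<chi> i j. if i = r \<or> j = r then of_bool (i = j) else A $ i $ j)"
proof -
  have "column r (\<chi> i j. if i = r \<and> j = r then 0 else A $ i $ j) = 0"
    using assms by (auto simp: column_def vec_eq_iff)
  then show ?thesis
    by (subst det_split_entry[of A r]) (simp add: det_zero_column(2))
qed

lemma minor_det_insert:
  assumes "conj_transpose H = H" "r \<notin> S"
  shows "minor_det (insert r S) H = H $ r $ r * minor_det S H
    + bordered_det S r (\<chi> i. if i \<in> S then H $ i $ r else 0) H"
proof -
  let ?A = "block (insert r S) H + proj (- insert r S)"
  have cH: "cnj (H $ i $ j) = H $ j $ i" for i j
    using assms(1) by (simp add: conj_transpose_def vec_eq_iff)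
  have "(\<chi> i j. if i = r \<or> j = r then of_bool (i = j) else ?A $ i $ j) = block S H + proj (- S)"
    using assms(2) by (auto simp: vec_eq_iff block_def proj_def)
  moreover have "(\<chi> i j. if i = r \<and> j = r then 0 else ?A $ i $ j) =
     block S H + outer (\<chi> i. if i \<in> S then H $ i $ r else 0) (axis r 1)
     + outer (axis r 1) (cnj_vec (\<chi> i. if i \<in> S then H $ i $ r else 0)) + proj (- insert r S)"
    using assms(2) by (auto simp: vec_eq_iff block_def proj_def outer_def cnj_vec_def axis_def cH)
  moreover have "?A $ r $ r = H $ r $ r"
    by (simp add: block_def proj_def)
  ultimately show ?thesis
    unfolding minor_det_def bordered_det_def by (subst det_split_entry[of ?A r]) simp
qed

text \<open>Row \<open>r\<close> and column \<open>r\<close> have a single entry each, at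
  \<open>s\<close>. Swapping the rows \<open>r\<close> and \<open>s\<close> costs a sign and moves
  \<open>cnj \<beta>\<close> and \<open>\<beta>\<close> to the diagonal; clearing these two pivots
  leaves the block on \<open>S - {s}\<close>.\<close>

lemma bordered_det_axis:
  assumes "s \<in> S" "r \<notin> S"
  shows "bordered_det S r (\<beta> *s axis s 1) H = - (\<beta> * cnj \<beta>) * minor_det (S - {s}) H"
proof -
  have rs: "r \<noteq> s" "s \<noteq> r" using assms by auto
  define B where "B = block S H + outer (\<beta> *s axis s 1) (axis r 1)
     + outer (axis r 1) (cnj_vec (\<beta> *s axis s 1)) + proj (- insert r S)"
  have B: "B $ i $ j = (if i \<in> S \<and> j \<in> S then H $ i $ j else if i = s \<and> j = r then \<beta>
     else if i = r \<and> j = s then cnj \<beta> else if i = j \<and> i \<notin> insert r S then 1 else 0)" for i j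
    using assms rs unfolding B_def block_def outer_def axis_def cnj_vec_def proj_def
    by (cases "i = r"; cases "j = r"; cases "i = s"; cases "j = s"; simp)
  define B1 where "B1 = (\<chi> i. B $ Transposition.transpose r s i)"
  have B1: "B1 $ i $ j = (if i = s then (if j = s then cnj \<beta> else 0)
     else if i = r then (if j \<in> S then H $ s $ j else if j = r then \<beta> else 0)
     else B $ i $ j)" for i j
    using assms rs by (cases "i = r"; cases "i = s"; cases "j = r"; cases "j = s"; simp add: B1_def B)
  define B2 :: "complex ^ 'a ^ 'a" where "B2 = (\<chi> i j. if i = s \<or> j = s then of_bool (i = j) else B1 $ i $ j)"
  define B3 :: "complex ^ 'a ^ 'a" where "B3 = (\<chi> i j. if i = r \<or> j = r then of_bool (i = j) else B2 $ i $ j)"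
  have "- det B = det B1"
    using rs det_permute_rows[of "Transposition.transpose r s" B]
    by (simp add: B1_def permutes_swap_id sign_swap_id)
  also have "\<dots> = B1 $ s $ s * det B2"
    unfolding B2_def by (intro det_pivot_row) (simp add: B1)
  also have "det B2 = B2 $ r $ r * det B3"
    unfolding B3_def
  proof (rule det_pivot_column)
    show "B2 $ i $ r = 0" if "i \<noteq> r" for i
      using assms rs that by (cases "i = s") (simp_all add: B2_def B1 B)
  qed
  also have "B3 = block (S - {s}) H + proj (- (S - {s}))"
    unfolding vec_eq_iff
  proof (intro allI)
    show "B3 $ i $ j = (block (S - {s}) H + proj (- (S - {s}))) $ i $ j" for i j
      using assms rs by (cases "i = r"; cases "i = s"; cases "j = r"; cases "j = s";
          simp add: B3_def B2_def B1 B block_def proj_def)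
  qed
  finally have eq: "- det B = B1 $ s $ s * (B2 $ r $ r * minor_det (S - {s}) H)"
    unfolding minor_det_def .
  have e1: "B1 $ s $ s = cnj \<beta>" and e2: "B2 $ r $ r = \<beta>"
    using assms rs by (simp_all add: B2_def B1)
  have "d = - (e * c) * m" if "- d = c * (e * m)" for c d e m :: complex
  proof -
    have "d = - (- d)" by simp
    also have "\<dots> = - (e * c) * m" unfolding that by simp
    finally show ?thesis .
  qed
  from this[OF eq[unfolded e1 e2]] show ?thesis
    unfolding bordered_det_def B_def .
qed

section \<open>Conjugation by Hermitian unitaries\<close>

lemma matrix_add_rdistrib: "(B + C) ** A = B ** A + C ** (A :: 'a::semiring_1 ^ 'n ^ 'm::finite)"
  by (simp add: vec_eq_iff matrix_matrix_mult_def distrib_right sum.distrib)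

text \<open>A Hermitian involution is unitary and its own inverse, so conjugation is simply
  \<open>U ** A ** U\<close>. The last condition confines its action to the coordinates in
  \<open>S\<close>.\<close>

definition hunitary_on :: "'n::finite set \<Rightarrow> complex ^ 'n ^ 'n \<Rightarrow> bool" where
  "hunitary_on S U \<longleftrightarrow> conj_transpose U = U \<and> U ** U = mat 1 \<and> U ** proj (- S) = proj (- S)"

lemma conj_transpose_mult:
  "conj_transpose (A ** B) = conj_transpose B ** conj_transpose A"
  by (simp add: conj_transpose_def matrix_matrix_mult_def vec_eq_iff mult.commute)

lemma conj_transpose_proj: "conj_transpose (proj S) = proj S"
  by (auto simp: conj_transpose_def proj_def vec_eq_iff)

lemma proj_mult: "proj S ** A = (\<chi> i j. if i \<in> S then A $ i $ j else 0)"
proof -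
  have "(proj S ** A) $ i $ j = (\<Sum>k\<in>UNIV. if k = i then (if i \<in> S then A $ i $ j else 0) else 0)" for i j
    unfolding proj_def matrix_matrix_mult_def vec_lambda_beta by (intro sum.cong) auto
  then show ?thesis by (simp add: vec_eq_iff)
qed

lemma mult_proj: "A ** proj S = (\<chi> i j. if j \<in> S then A $ i $ j else 0)"
proof -
  have "(A ** proj S) $ i $ j = (\<Sum>k\<in>UNIV. if k = j then (if j \<in> S then A $ i $ j else 0) else 0)" for i j
    unfolding proj_def matrix_matrix_mult_def vec_lambda_beta by (intro sum.cong) auto
  then show ?thesis by (simp add: vec_eq_iff)
qed

lemma proj_mult_vec: "proj S *v v = (\<chi> i. if i \<in> S then v $ i else 0)"
proof -
  have "(proj S *v v) $ i = (\<Sum>k\<in>UNIV. if k = i then (if i \<in> S then v $ i else 0) else 0)" for i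
    unfolding proj_def matrix_vector_mult_def vec_lambda_beta by (intro sum.cong) auto
  then show ?thesis by (simp add: vec_eq_iff)
qed

lemma vec_mult_proj: "v v* proj S = (\<chi> i. if i \<in> S then v $ i else 0)"
proof -
  have "(v v* proj S) $ i = (\<Sum>k\<in>UNIV. if k = i then (if i \<in> S then v $ i else 0) else 0)" for i
    unfolding proj_def vector_matrix_mult_def vec_lambda_beta by (intro sum.cong) auto
  then show ?thesis by (simp add: vec_eq_iff)
qed

lemma block_eq_proj: "block S H = proj S ** H ** proj S"
  by (auto simp: block_def proj_mult mult_proj vec_eq_iff)

lemma outer_mult: "A ** outer u v = outer (A *v u) v" "outer u v ** A = outer u (v v* A)"
  by (simp_all add: outer_def matrix_matrix_mult_def matrix_vector_mult_def vector_matrix_mult_def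
      vec_eq_iff sum_distrib_left sum_distrib_right ac_simps)

context
  fixes S :: "'n::finite set" and U :: "complex ^ 'n ^ 'n"
  assumes U: "hunitary_on S U"
begin

lemma hunitary_UU: "U ** U = mat 1" and hunitary_herm: "conj_transpose U = U"
  using U by (auto simp: hunitary_on_def)

lemma hunitary_proj:
  assumes "T \<subseteq> - S"
  shows "U ** proj T = proj T" "proj T ** U = proj T"
proof -
  have T: "proj T = proj (- S) ** proj T"
    using assms unfolding proj_mult by (auto simp: proj_def vec_eq_iff)
  have "U ** proj (- S) = proj (- S)" using U by (simp add: hunitary_on_def)
  then show *: "U ** proj T = proj T"
    by (subst (1 2) T) (simp add: matrix_mul_assoc)
  show "proj T ** U = proj T"
    using arg_cong[OF *, of conj_transpose] by (simp add: conj_transpose_mult conj_transpose_proj hunitary_herm)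
qed

lemma hunitary_commute: "U ** proj S = proj S ** U"
proof -
  have S: "proj S + proj (- S) = mat 1" by (auto simp: proj_def mat_def vec_eq_iff)
  have "U ** (proj S + proj (- S)) = (proj S + proj (- S)) ** U"
    unfolding S by simp
  then show ?thesis
    by (simp add: matrix_add_ldistrib matrix_add_rdistrib hunitary_proj)
qed

lemma hunitary_axis:
  assumes "r \<notin> S"
  shows "U *v axis r 1 = axis r 1" "axis r 1 v* U = axis r 1"
proof -
  have r: "axis r 1 = proj (- S) *v axis r 1" "axis r 1 = axis r 1 v* proj (- S)"
    using assms by (auto simp: proj_mult_vec vec_mult_proj axis_def vec_eq_iff)
  show "U *v axis r 1 = axis r 1"
    by (subst (1 2) r(1)) (simp add: matrix_vector_mul_assoc hunitary_proj)
  show "axis r 1 v* U = axis r 1"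
    by (subst (1 2) r(2)) (simp add: vector_matrix_mul_assoc hunitary_proj)
qed

lemma cnj_vec_mult: "cnj_vec b v* U = cnj_vec (U *v b)"
proof -
  have "cnj (U $ j $ i) = U $ i $ j" for i j
    using arg_cong[OF hunitary_herm, of "\<lambda>A. A $ i $ j"] by (simp add: conj_transpose_def)
  then show ?thesis
    by (simp add: cnj_vec_def matrix_vector_mult_def vector_matrix_mult_def vec_eq_iff mult.commute)
qed

lemma det_hunitary_conj: "det (U ** A ** U) = det A"
proof -
  have "det U * det U = 1" using hunitary_UU det_mul[of U U] by (simp add: det_I)
  moreover have "det (U ** A ** U) = (det U * det U) * det A" by (simp add: det_mul ac_simps)
  ultimately show ?thesis by simp
qed

lemma block_hunitary_conj: "U ** block S H ** U = block S (U ** H ** U)"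
proof -
  have "U ** (proj S ** H ** proj S) ** U = (U ** proj S) ** H ** (proj S ** U)"
    by (simp add: matrix_mul_assoc)
  also have "\<dots> = proj S ** (U ** H ** U) ** proj S"
    by (metis hunitary_commute matrix_mul_assoc)
  finally show ?thesis by (simp add: block_eq_proj)
qed

lemma minor_det_hunitary: "minor_det S (U ** H ** U) = minor_det S H"
proof -
  have "U ** (block S H + proj (- S)) ** U = block S (U ** H ** U) + proj (- S)"
    by (simp add: matrix_add_ldistrib matrix_add_rdistrib block_hunitary_conj hunitary_proj)
  then show ?thesis
    unfolding minor_det_def using det_hunitary_conj[of "block S H + proj (- S)"] by simp
qed

text \<open>Conjugation by \<open>U\<close> commutes with taking the block, fixes the padding and
  the axis \<open>r\<close>, and carries the border \<open>b\<close> to \<open>U *v b\<close>; the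
  determinant is unchanged because \<open>det U\<close> squares to 1.\<close>

lemma bordered_det_hunitary:
  assumes "r \<notin> S"
  shows "bordered_det S r (U *v b) (U ** H ** U) = bordered_det S r b H"
proof -
  have "U ** (block S H + outer b (axis r 1) + outer (axis r 1) (cnj_vec b) + proj (- insert r S)) ** U
      = block S (U ** H ** U) + outer (U *v b) (axis r 1) + outer (axis r 1) (cnj_vec (U *v b))
        + proj (- insert r S)"
    using assms
    by (simp add: matrix_add_ldistrib matrix_add_rdistrib block_hunitary_conj hunitary_proj outer_mult
        hunitary_axis cnj_vec_mult subset_insertI)
  then show ?thesis
    unfolding bordered_det_def
    using det_hunitary_conj[of "block S H + outer b (axis r 1) + outer (axis r 1) (cnj_vec b) + proj (- insert r S)"]
    by simp
qed

end

section \<open>Householder reflections\<close>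

lemma matrix_diff_ldistrib: "A ** (B - C) = A ** B - A ** (C :: 'a::ring_1 ^ 'n ^ 'm::finite)"
  by (simp add: vec_eq_iff matrix_matrix_mult_def right_diff_distrib sum_subtractf)

lemma matrix_diff_rdistrib: "(B - C) ** A = B ** A - C ** (A :: 'a::ring_1 ^ 'n ^ 'm::finite)"
  by (simp add: vec_eq_iff matrix_matrix_mult_def left_diff_distrib sum_subtractf)

text \<open>The Hermitian form, conjugate-linear on the left; the inner product
  \<open>\<bullet>\<close> on this type is its real part.\<close>

definition cdot :: "complex ^ 'n::finite \<Rightarrow> complex ^ 'n \<Rightarrow> complex" where
  "cdot u v = (\<Sum>i\<in>UNIV. cnj (u $ i) * v $ i)"

lemma cdot_commute: "cdot u v = cnj (cdot v u)"
  by (simp add: cdot_def mult.commute)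

lemma cdot_diff_left: "cdot (u - w) v = cdot u v - cdot w v"
  by (simp add: cdot_def algebra_simps sum_subtractf)

lemma cdot_diff_right: "cdot u (v - w) = cdot u v - cdot u w"
  by (simp add: cdot_def algebra_simps sum_subtractf)

lemma cdot_axis: "cdot u (\<beta> *s axis s 1) = \<beta> * cnj (u $ s)"
proof -
  have "cdot u (\<beta> *s axis s 1) = (\<Sum>i\<in>UNIV. if i = s then \<beta> * cnj (u $ s) else 0)"
    unfolding cdot_def by (intro sum.cong) (auto simp: axis_def)
  then show ?thesis by simp
qed

lemma cdot_self: "cdot v v = of_real (\<Sum>i\<in>UNIV. (cmod (v $ i))\<^sup>2)"
  unfolding cdot_def of_real_sum by (intro sum.cong) (auto simp: complex_norm_square mult.commute simp del: of_real_power)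

lemma cdot_self_eq_0: "cdot v v = 0 \<longleftrightarrow> v = 0"
  unfolding cdot_self of_real_eq_0_iff
  by (subst sum_nonneg_eq_0_iff) (auto simp: vec_eq_iff)

lemma outer_vec: "outer u (cnj_vec v) *v x = cdot v x *s u"
  by (simp add: outer_def cnj_vec_def cdot_def matrix_vector_mult_def vec_eq_iff sum_distrib_left sum_distrib_right ac_simps)

lemma hunitary_reflection_exists:
  fixes b :: "complex ^ 'n::finite"
  assumes s: "s \<in> S" and b: "\<And>i. i \<notin> S \<Longrightarrow> b $ i = 0"
  shows "\<exists>U \<beta>. hunitary_on S U \<and> U *v b = \<beta> *s axis s 1 \<and> \<beta> * cnj \<beta> = cdot b b"
proof -
  define N where "N = sqrt (\<Sum>i\<in>UNIV. (cmod (b $ i))\<^sup>2)"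
  have N2: "of_real N * of_real N = cdot b b"
    unfolding N_def cdot_self by (simp add: sum_nonneg flip: of_real_mult)
  \<comment> \<open>The phase makes the scalar product of b with its image real, so that the reflection in their difference exchanges them.\<close>
  define \<beta> where "\<beta> = of_real N * (if b $ s = 0 then 1 else sgn (b $ s))"
  have bb: "\<beta> * cnj \<beta> = cdot b b"
  proof -
    have "sgn z * cnj (sgn z) = 1" if "z \<noteq> 0" for z :: complex
      using that by (simp add: complex_norm_square[symmetric] norm_sgn flip: of_real_power)
    then show ?thesis
      by (simp add: \<beta>_def N2[symmetric] algebra_simps)
  qed
  have real: "\<beta> * cnj (b $ s) = cnj \<beta> * b $ s"
    by (auto simp: \<beta>_def sgn_div_norm scaleR_conv_of_real ac_simps)
  define w where "w = b - \<beta> *s axis s 1"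
  have wS: "w $ i = 0" if "i \<notin> S" for i
    using that s b by (auto simp: w_def axis_def)
  \<comment> \<open>For nonzero \<open>w\<close> this gives \<open>c * cdot w b = 1\<close> below,
    hence the reflection sends \<open>b\<close> to \<open>b - w\<close>.\<close>
  have ww: "cdot w w = 2 * cdot w b"
  proof -
    have 1: "cdot w b = cdot b b - cnj \<beta> * b $ s"
      unfolding w_def cdot_diff_left by (subst (2) cdot_commute) (simp add: cdot_axis)
    have 2: "cdot w (\<beta> *s axis s 1) = \<beta> * cnj (b $ s) - \<beta> * cnj \<beta>"
      unfolding cdot_axis by (simp add: w_def algebra_simps)
    have "cdot w w = cdot w b - cdot w (\<beta> *s axis s 1)"
      by (subst (2) w_def) (rule cdot_diff_right)
    then show ?thesis
      unfolding 1 2 by (simp add: bb real)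
  qed
  \<comment> \<open>For \<open>w = 0\<close> the quotient is 0 by convention; then \<open>U\<close>
    is the identity and \<open>b\<close> lies on the axis already.\<close>
  define c where "c = 2 / cdot w w"
  define Q where "Q = outer (c *s w) (cnj_vec w)"
  define U where "U = mat 1 - Q"
  have cw: "c * cdot w w * x = 2 * x" if "w \<noteq> 0" for x
    using that cdot_self_eq_0[of w] by (simp add: c_def)
  have Q: "Q $ i $ j = c * (w $ i * cnj (w $ j))" for i j
    by (simp add: Q_def outer_def cnj_vec_def mult.assoc)
  have Qv: "Q *v x = (c * cdot w x) *s w" for x
    by (simp add: Q_def outer_vec vec_eq_iff ac_simps)
  have "Q ** Q = outer (Q *v (c *s w)) (cnj_vec w)"
    by (subst (2) Q_def) (simp add: outer_mult)
  also have "Q *v (c *s w) = (2 * c) *s w"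
  proof (cases "w = 0")
    case False
    have "cdot w (c *s w) = c * cdot w w"
      by (simp add: cdot_def sum_distrib_left mult.left_commute)
    then show ?thesis using cw[OF False, of c] by (simp add: Qv ac_simps)
  qed (simp add: Qv)
  also have "outer ((2 * c) *s w) (cnj_vec w) = Q + Q"
    by (simp add: Q_def outer_def vec_eq_iff algebra_simps)
  finally have QQ: "Q ** Q = Q + Q" .
  have "cnj c = c" unfolding c_def by (simp add: cdot_self)
  then have "conj_transpose U = U"
    by (simp add: U_def conj_transpose_def mat_def Q vec_eq_iff mult.commute)
  moreover have "U ** U = mat 1"
    by (simp add: U_def matrix_diff_ldistrib matrix_diff_rdistrib QQ)
  moreover have "U ** proj (- S) = proj (- S)"
    unfolding mult_proj using wS
    by (simp add: U_def Q vec_eq_iff proj_def mat_def)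
  moreover have "U *v b = \<beta> *s axis s 1"
  proof -
    have "U *v b = b - Q *v b"
      by (simp add: U_def matrix_vector_mult_diff_rdistrib)
    also have "\<dots> = b - w"
    proof (cases "w = 0")
      case False
      have "2 * (c * cdot w b) = 2 * 1"
        using cw[OF False, of 1] ww by simp
      then show ?thesis by (simp add: Qv del: mult_1_right)
    qed (simp add: Qv)
    also have "\<dots> = \<beta> *s axis s 1" by (simp add: w_def)
    finally show ?thesis .
  qed
  ultimately show ?thesis
    using bb unfolding hunitary_on_def by blast
qed

section \<open>Unitary conjugation as a rotation of matrix space\<close>

lemma norm_matrix_trace:
  "of_real ((norm (G :: complex ^ 'n ^ 'n::finite))\<^sup>2) = trace (conj_transpose G ** G)"
proof -
  have "(norm G)\<^sup>2 = (\<Sum>i\<in>UNIV. \<Sum>j\<in>UNIV. (cmod (G $ i $ j))\<^sup>2)"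
    unfolding power2_norm_eq_inner by (simp add: inner_vec_def power2_norm_eq_inner)
  also have "complex_of_real \<dots> = (\<Sum>i\<in>UNIV. \<Sum>j\<in>UNIV. cnj (G $ i $ j) * G $ i $ j)"
    by (simp add: complex_norm_square mult.commute del: of_real_power)
  also have "\<dots> = trace (conj_transpose G ** G)"
    unfolding trace_def matrix_matrix_mult_def conj_transpose_def by (subst sum.swap) simp
  finally show ?thesis .
qed

text \<open>The squared norm is a trace and traces are cyclic, so the inner and outer factors
  \<open>U\<close> cancel in pairs. This puts unitary conjugation within reach of the orthogonal
  invariance of \<open>ginibre\<close>.\<close>

lemma orthogonal_hunitary_conj:
  assumes U: "hunitary_on S U"
  shows "orthogonal_transformation (\<lambda>G. U ** G ** U)"
  unfolding orthogonal_transformation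
proof (intro conjI allI)
  show "linear (\<lambda>G. U ** G ** U)"
    by (intro linearI)
      (simp_all add: matrix_add_ldistrib matrix_add_rdistrib,
       simp add: vec_eq_iff matrix_matrix_mult_def scaleR_sum_right sum_distrib_right)
  fix G
  have "conj_transpose (U ** G ** U) ** (U ** G ** U) = U ** (conj_transpose G ** (U ** U) ** G ** U)"
    by (simp add: conj_transpose_mult hunitary_herm[OF U] matrix_mul_assoc)
  also have "trace \<dots> = trace (conj_transpose G ** (U ** U) ** G ** (U ** U))"
    by (subst trace_mul_sym) (simp add: matrix_mul_assoc)
  also have "\<dots> = trace (conj_transpose G ** G)"
    by (simp add: hunitary_UU[OF U])
  finally have "(norm (U ** G ** U))\<^sup>2 = (norm G)\<^sup>2"
    unfolding norm_matrix_trace[symmetric] of_real_eq_iff .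
  then show "norm (U ** G ** U) = norm G" by simp
qed

definition hermitize :: "complex ^ 'n ^ 'n \<Rightarrow> complex ^ 'n ^ 'n" where
  "hermitize G = (1/2) *\<^sub>R (G + conj_transpose G)"

lemma conj_transpose_hermitize: "conj_transpose (hermitize G) = hermitize G"
  by (simp add: hermitize_def conj_transpose_def vec_eq_iff add.commute)

text \<open>Since \<open>U\<close> is Hermitian, the adjoint passes through the conjugation; thus
  invariance of the Ginibre law descends to hermitized matrices.\<close>

lemma hermitize_hunitary:
  assumes U: "hunitary_on S U"
  shows "hermitize (U ** G ** U) = U ** hermitize G ** U"
proof -
  have sc: "U ** ((1/2) *\<^sub>R A) ** U = (1/2) *\<^sub>R (U ** A ** U)" for A
    using linear_scale[OF orthogonal_transformation_linear[OF orthogonal_hunitary_conj[OF U]]] .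
  show ?thesis
    unfolding hermitize_def sc
    by (simp add: conj_transpose_mult hunitary_herm[OF U] matrix_mul_assoc matrix_add_ldistrib matrix_add_rdistrib)
qed

section \<open>Moments and independence of Gaussian coordinates\<close>

text \<open>Asking for every power makes the class closed under products as well as sums, hence
  under powers and determinants, so that integrability of polynomials in the entries follows from
  closure rules.\<close>

definition all_moments :: "'a measure \<Rightarrow> ('a \<Rightarrow> complex) \<Rightarrow> bool" where
  "all_moments M f \<longleftrightarrow> f \<in> borel_measurable M \<and> (\<forall>p. integrable M (\<lambda>x. cmod (f x) ^ p))"

lemma all_moments_measurable: "all_moments M f \<Longrightarrow> f \<in> borel_measurable M"
  by (simp add: all_moments_def)

lemma all_moments_integrable:
  assumes "all_moments M f"
  shows "integrable M f"
proof -
  have "integrable M (\<lambda>x. cmod (f x) ^ 1)"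
    using assms unfolding all_moments_def by blast
  then show ?thesis
    using assms by (simp add: integrable_norm_iff all_moments_def)
qed

lemma all_moments_const: "prob_space M \<Longrightarrow> all_moments M (\<lambda>_. c)"
  unfolding all_moments_def by (simp add: prob_space.finite_measure finite_measure.integrable_const)

lemma all_moments_add:
  assumes f: "all_moments M f" and g: "all_moments M g"
  shows "all_moments M (\<lambda>x. f x + g x)"
  unfolding all_moments_def
proof (intro conjI allI)
  note [measurable] = f[THEN all_moments_measurable] g[THEN all_moments_measurable]
  show "(\<lambda>x. f x + g x) \<in> borel_measurable M" by measurable
  fix p
  have bound: "cmod (a + b) ^ p \<le> 2 ^ p * (cmod a ^ p + cmod b ^ p)" for a b
  proof -
    have "cmod (a + b) ^ p \<le> (2 * max (cmod a) (cmod b)) ^ p"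
      using norm_triangle_ineq[of a b] by (intro power_mono) auto
    also have "\<dots> \<le> 2 ^ p * (cmod a ^ p + cmod b ^ p)"
      by (auto simp: power_mult_distrib max_def)
    finally show ?thesis .
  qed
  have "integrable M (\<lambda>x. 2 ^ p * (cmod (f x) ^ p + cmod (g x) ^ p))"
    using f g by (simp add: all_moments_def)
  then show "integrable M (\<lambda>x. cmod (f x + g x) ^ p)"
    by (rule Bochner_Integration.integrable_bound) (auto simp: intro!: bound AE_I2 order_trans[OF bound])
qed

lemma all_moments_mult:
  assumes f: "all_moments M f" and g: "all_moments M g"
  shows "all_moments M (\<lambda>x. f x * g x)"
  unfolding all_moments_def
proof (intro conjI allI)
  note [measurable] = f[THEN all_moments_measurable] g[THEN all_moments_measurable]
  show "(\<lambda>x. f x * g x) \<in> borel_measurable M" by measurable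
  fix p
  have bound: "cmod (a * b) ^ p \<le> cmod a ^ (2 * p) + cmod b ^ (2 * p)" for a b
  proof -
    have "0 \<le> (cmod a ^ p - cmod b ^ p)\<^sup>2 + (cmod a ^ p)\<^sup>2 + (cmod b ^ p)\<^sup>2" by simp
    then have "cmod a ^ p * cmod b ^ p \<le> (cmod a ^ p)\<^sup>2 + (cmod b ^ p)\<^sup>2"
      by (simp add: power2_diff)
    then show ?thesis
      by (simp add: norm_mult power_mult_distrib power_mult[symmetric] mult.commute)
  qed
  have "integrable M (\<lambda>x. cmod (f x) ^ (2 * p) + cmod (g x) ^ (2 * p))"
    using f g by (simp add: all_moments_def)
  then show "integrable M (\<lambda>x. cmod (f x * g x) ^ p)"
    by (rule Bochner_Integration.integrable_bound) (auto intro!: AE_I2 order_trans[OF bound])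
qed

lemma all_moments_sum:
  "prob_space M \<Longrightarrow> (\<And>i. i \<in> A \<Longrightarrow> all_moments M (f i)) \<Longrightarrow> all_moments M (\<lambda>x. \<Sum>i\<in>A. f i x)"
  by (induction A rule: infinite_finite_induct) (simp_all add: all_moments_const all_moments_add)

lemma all_moments_prod:
  "prob_space M \<Longrightarrow> (\<And>i. i \<in> A \<Longrightarrow> all_moments M (f i)) \<Longrightarrow> all_moments M (\<lambda>x. \<Prod>i\<in>A. f i x)"
  by (induction A rule: infinite_finite_induct) (simp_all add: all_moments_const all_moments_mult)

lemma all_moments_power:
  "prob_space M \<Longrightarrow> all_moments M f \<Longrightarrow> all_moments M (\<lambda>x. f x ^ p)"
  by (induction p) (simp_all add: all_moments_const all_moments_mult)

lemma all_moments_det: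
  assumes "prob_space M" "\<And>i j. all_moments M (\<lambda>x. A x $ i $ j)"
  shows "all_moments M (\<lambda>x. det (A x :: complex ^ 'n ^ 'n::finite))"
  unfolding det_def using assms
  by (intro all_moments_sum all_moments_mult all_moments_prod all_moments_const)

section \<open>Freezing a subset of the coordinates\<close>

text \<open>Coordinates in \<open>I\<close> from one sample and the rest from an independent one
  reproduce the law: a rectangle pulls back to \<open>A1 \<times> A2\<close>, where each coordinate
  is constrained in just one of the two factors. All functions thus stay on one index type.\<close>

lemma distr_PiM_merge:
  fixes N :: "'b measure" and I :: "'i::finite set"
  assumes "prob_space N"
  defines "\<mu> \<equiv> PiM UNIV (\<lambda>_::'i. N)"
  shows "distr (\<mu> \<Otimes>\<^sub>M \<mu>) \<mu> (\<lambda>(x, y) c. if c \<in> I then x c else y c) = \<mu>"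
    and "(\<lambda>(x, y) c. if c \<in> I then x c else y c) \<in> measurable (\<mu> \<Otimes>\<^sub>M \<mu>) \<mu>"
proof -
  interpret N: prob_space N by fact
  interpret P: product_prob_space "\<lambda>_::'i. N" UNIV by standard
  interpret F: finite_product_sigma_finite "\<lambda>_::'i. N" UNIV by standard simp
  interpret Q: prob_space \<mu>
    unfolding \<mu>_def by (intro prob_space_PiM N.prob_space_axioms)
  have sp: "space \<mu> = (\<Pi>\<^sub>E i\<in>UNIV. space N)" by (simp add: \<mu>_def space_PiM)
  have [measurable]: "(\<lambda>x. x c) \<in> measurable \<mu> N" for c
    unfolding \<mu>_def by measurable
  show m: "(\<lambda>(x, y) c. if c \<in> I then x c else y c) \<in> measurable (\<mu> \<Otimes>\<^sub>M \<mu>) \<mu>"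
    \<comment> \<open>Only the target is unfolded to a product; the source keeps its form as two
      copies of \<open>\<mu>\<close>.\<close>
    unfolding \<mu>_def[THEN meta_eq_to_obj_eq, THEN arg_cong[of _ _ "measurable (\<mu> \<Otimes>\<^sub>M \<mu>)"]]
  proof (rule measurable_PiM_single')
    fix c :: 'i
    show "(\<lambda>\<omega>. (case \<omega> of (x, y) \<Rightarrow> \<lambda>c. if c \<in> I then x c else y c) c) \<in> measurable (\<mu> \<Otimes>\<^sub>M \<mu>) N"
      by (cases "c \<in> I") (simp_all add: case_prod_beta)
  qed (auto simp: space_pair_measure sp PiE_def Pi_def)
  show "distr (\<mu> \<Otimes>\<^sub>M \<mu>) \<mu> (\<lambda>(x, y) c. if c \<in> I then x c else y c) = \<mu>"
    unfolding \<mu>_def[THEN meta_eq_to_obj_eq, THEN arg_cong[of _ _ "\<lambda>x. _ = x"]]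
  proof (rule P.PiM_eqI)
    fix A :: "'i \<Rightarrow> 'b set" assume A: "\<And>i. i \<in> UNIV \<Longrightarrow> A i \<in> sets N"
    define A1 where "A1 = (\<Pi>\<^sub>E c\<in>UNIV. if c \<in> I then A c else space N)"
    define A2 where "A2 = (\<Pi>\<^sub>E c\<in>UNIV. if c \<in> I then space N else A c)"
    have AS: "A1 \<in> sets \<mu>" "A2 \<in> sets \<mu>" "Pi\<^sub>E UNIV A \<in> sets \<mu>"
      unfolding \<mu>_def A1_def A2_def using A by (auto intro!: sets_PiM_I_finite)
    have "(\<lambda>(x, y) c. if c \<in> I then x c else y c) -` Pi\<^sub>E UNIV A \<inter> space (\<mu> \<Otimes>\<^sub>M \<mu>) = A1 \<times> A2"
      using A[THEN sets.sets_into_space]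
      by (fastforce simp: A1_def A2_def space_pair_measure sp PiE_def Pi_def split: if_splits)
    then have "emeasure (distr (\<mu> \<Otimes>\<^sub>M \<mu>) \<mu> (\<lambda>(x, y) c. if c \<in> I then x c else y c)) (Pi\<^sub>E UNIV A)
       = emeasure \<mu> A1 * emeasure \<mu> A2"
      using AS by (simp add: emeasure_distr[OF m] Q.emeasure_pair_measure_Times)
    also have "\<dots> = (\<Prod>c\<in>UNIV. emeasure N (if c \<in> I then A c else space N) * emeasure N (if c \<in> I then space N else A c))"
      unfolding A1_def A2_def \<mu>_def prod.distrib
      by (subst (1 2) F.measure_times) (use A in auto)
    also have "\<dots> = (\<Prod>c\<in>UNIV. emeasure N (A c))"
      by (intro prod.cong) (auto simp: N.emeasure_space_1)
    finally show "emeasure (distr (\<mu> \<Otimes>\<^sub>M \<mu>) \<mu> (\<lambda>(x, y) c. if c \<in> I then x c else y c)) (Pi\<^sub>E UNIV A)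
      = (\<Prod>c\<in>UNIV. emeasure N (A c))" .
  qed (simp_all add: \<mu>_def)
qed

text \<open>The inner integral is the conditional expectation given the coordinates outside
  \<open>I\<close>, which are held at \<open>y\<close>.\<close>

lemma integral_PiM_merge:
  fixes N :: "'b measure" and I :: "'i::finite set"
    and f :: "('i \<Rightarrow> 'b) \<Rightarrow> 'c::{banach, second_countable_topology}"
  assumes N: "prob_space N"
  defines "\<mu> \<equiv> PiM UNIV (\<lambda>_::'i. N)"
  assumes f: "integrable \<mu> f"
  shows "(\<integral>x. f x \<partial>\<mu>) = (\<integral>y. (\<integral>x. f (\<lambda>c. if c \<in> I then x c else y c) \<partial>\<mu>) \<partial>\<mu>)"
proof -
  interpret N: prob_space N by fact
  interpret P: product_prob_space "\<lambda>_::'i. N" UNIV by standard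
  interpret Q: prob_space \<mu>
    unfolding \<mu>_def by (intro prob_space_PiM N.prob_space_axioms)
  interpret pair_prob_space \<mu> \<mu> ..
  let ?m = "\<lambda>(x, y) c. if c \<in> I then x c else y c"
  have d: "distr (\<mu> \<Otimes>\<^sub>M \<mu>) \<mu> ?m = \<mu>" and m: "?m \<in> measurable (\<mu> \<Otimes>\<^sub>M \<mu>) \<mu>"
    unfolding \<mu>_def using distr_PiM_merge[OF N, of I] by auto
  have fm: "f \<in> borel_measurable \<mu>" using f by (rule borel_measurable_integrable)
  have int: "integrable (\<mu> \<Otimes>\<^sub>M \<mu>) (\<lambda>z. f (?m z))"
    using f by (subst integrable_distr_eq[OF m fm, symmetric]) (simp only: d)
  have "(\<integral>x. f x \<partial>\<mu>) = (\<integral>x. f x \<partial>distr (\<mu> \<Otimes>\<^sub>M \<mu>) \<mu> ?m)"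
    by (simp only: d)
  also have "\<dots> = (\<integral>z. f (?m z) \<partial>(\<mu> \<Otimes>\<^sub>M \<mu>))"
    by (rule integral_distr[OF m fm])
  also have "\<dots> = (\<integral>y. (\<integral>x. f (\<lambda>c. if c \<in> I then x c else y c) \<partial>\<mu>) \<partial>\<mu>)"
    using integral_snd[of "\<lambda>x y. f (\<lambda>c. if c \<in> I then x c else y c)"] int by (simp add: case_prod_unfold)
  finally show ?thesis .
qed

definition depends_on :: "'i set \<Rightarrow> (('i \<Rightarrow> 'b) \<Rightarrow> 'c) \<Rightarrow> bool" where
  "depends_on I f \<longleftrightarrow> (\<forall>x y. (\<forall>c\<in>I. x c = y c) \<longrightarrow> f x = f y)"

abbreviation gauss :: "('i::finite \<Rightarrow> real) measure" where
  "gauss \<equiv> PiM UNIV (\<lambda>_. std_normal)"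

lemma prob_space_std_normal: "prob_space std_normal"
  unfolding std_normal_def by (rule prob_space_normal_density) simp

lemma prob_space_gauss: "prob_space (gauss :: ('i::finite \<Rightarrow> real) measure)"
  by (intro prob_space_PiM prob_space_std_normal)

lemmas moments_intros = all_moments_const[OF prob_space_gauss] all_moments_add all_moments_mult
  all_moments_sum[OF prob_space_gauss] all_moments_prod[OF prob_space_gauss]
  all_moments_power[OF prob_space_gauss] all_moments_det[OF prob_space_gauss]

text \<open>Merging turns the integrand into \<open>f x * g y\<close>, so the iterated integral
  factors.\<close>

lemma integral_gauss_mult_independent:
  fixes f g :: "('i::finite \<Rightarrow> real) \<Rightarrow> complex"
  assumes f: "all_moments gauss f" "depends_on I f"
    and g: "all_moments gauss g" "depends_on (- I) g"
  shows "(\<integral>x. f x * g x \<partial>gauss) = (\<integral>x. f x \<partial>gauss) * (\<integral>x. g x \<partial>gauss)"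
proof -
  have fm: "f (\<lambda>c. if c \<in> I then x c else y c) = f x" for x y
    by (rule f(2)[unfolded depends_on_def, rule_format]) simp
  have gm: "g (\<lambda>c. if c \<in> I then x c else y c) = g y" for x y
    by (rule g(2)[unfolded depends_on_def, rule_format]) simp
  have "(\<integral>x. f x * g x \<partial>gauss) = (\<integral>y. (\<integral>x. f x * g y \<partial>gauss) \<partial>gauss)"
    using all_moments_integrable[OF all_moments_mult[OF f(1) g(1)]]
    by (subst integral_PiM_merge[OF prob_space_std_normal, where I = I]) (simp_all add: fm gm)
  then show ?thesis by simp
qed

section \<open>Normal and Gamma moments\<close>

lemma integrable_std_normal_power: "integrable std_normal (\<lambda>x. \<bar>x\<bar> ^ p)"
  unfolding std_normal_def
  by (subst integrable_density) (use integrable_std_normal_moment_abs in auto)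

lemma distr_gauss_component: "distr gauss std_normal (\<lambda>x. x c) = std_normal"
proof -
  interpret prob_space std_normal by (rule prob_space_std_normal)
  interpret product_prob_space "\<lambda>_::'a. std_normal" UNIV by standard
  show ?thesis by (rule PiM_component) simp
qed

lemma component_measurable: "(\<lambda>x. x c) \<in> measurable gauss std_normal"
  by (rule measurable_component_singleton) simp

lemma measurable_of_real_std_normal: "(\<lambda>x. complex_of_real x ^ l) \<in> borel_measurable std_normal"
  by (simp add: std_normal_def)

lemma all_moments_component: "all_moments gauss (\<lambda>x. complex_of_real (x c))"
  unfolding all_moments_def
proof (intro conjI allI)
  show "(\<lambda>x. complex_of_real (x c)) \<in> borel_measurable gauss"
    using measurable_compose[OF component_measurable measurable_of_real_std_normal[of 1]] by simp
  have m: "(\<lambda>x. \<bar>x\<bar> ^ p :: real) \<in> borel_measurable std_normal" for p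
    by (simp add: std_normal_def)
  show "integrable gauss (\<lambda>x. cmod (complex_of_real (x c)) ^ p)" for p
    using integrable_std_normal_power[of p] integrable_distr_eq[OF component_measurable m[of p]]
    by (simp add: distr_gauss_component)
qed

lemma integral_component_power:
  "(\<integral>x. complex_of_real (x c) ^ l \<partial>gauss) = of_real (normal_moment l)"
proof -
  have "(\<integral>x. complex_of_real (x c) ^ l \<partial>gauss) = (\<integral>z. complex_of_real z ^ l \<partial>distr gauss std_normal (\<lambda>x. x c))"
    by (rule integral_distr[OF component_measurable measurable_of_real_std_normal, symmetric])
  also have "\<dots> = (\<integral>z. complex_of_real (z ^ l) \<partial>std_normal)"
    by (simp add: distr_gauss_component)
  also have "\<dots> = of_real (\<integral>z. z ^ l \<partial>std_normal)"
    by (rule integral_complex_of_real)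
  also have "(\<integral>z. z ^ l \<partial>std_normal) = (\<integral>z. std_normal_density z * z ^ l \<partial>lborel)"
    unfolding std_normal_def by (subst integral_density) auto
  also have "\<dots> = normal_moment l"
  proof (cases "even l")
    case True
    then obtain k where "l = 2 * k" by blast
    then show ?thesis by (simp add: integral_std_normal_moment_even normal_moment_def)
  next
    case False
    then obtain k where "l = 2 * k + 1" by (blast elim: oddE)
    then show ?thesis using integral_std_normal_moment_odd[of k] by (simp add: normal_moment_def)
  qed
  finally show ?thesis .
qed

text \<open>The rising factorials are the moments of the Gamma law with shape \<open>a\<close> and
  unit scale.\<close>

definition gamma_moments :: "(('i::finite \<Rightarrow> real) \<Rightarrow> complex) \<Rightarrow> complex \<Rightarrow> bool" where
  "gamma_moments f a \<longleftrightarrow> all_moments gauss f \<and> (\<forall>m. (\<integral>x. f x ^ m \<partial>gauss) = pochhammer a m)"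

lemma depends_on_comp: "depends_on I f \<Longrightarrow> depends_on I (\<lambda>x. h (f x))"
  unfolding depends_on_def by metis

lemma depends_on_component: "c \<in> I \<Longrightarrow> depends_on I (\<lambda>x. h (x c))"
  by (simp add: depends_on_def)

lemma integral_binomial_independent:
  fixes f g :: "('i::finite \<Rightarrow> real) \<Rightarrow> complex"
  assumes f: "all_moments gauss f" "depends_on I f"
    and g: "all_moments gauss g" "depends_on (- I) g"
  shows "(\<integral>x. (f x + g x) ^ m \<partial>gauss) =
     (\<Sum>k\<le>m. of_nat (m choose k) * (\<integral>x. f x ^ k \<partial>gauss) * (\<integral>x. g x ^ (m - k) \<partial>gauss))"
proof -
  have "(\<integral>x. (f x + g x) ^ m \<partial>gauss) = (\<integral>x. (\<Sum>k\<le>m. of_nat (m choose k) * (f x ^ k * g x ^ (m - k))) \<partial>gauss)"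
    by (simp add: binomial_ring mult.assoc)
  also have "\<dots> = (\<Sum>k\<le>m. (\<integral>x. of_nat (m choose k) * (f x ^ k * g x ^ (m - k)) \<partial>gauss))"
    by (intro Bochner_Integration.integral_sum all_moments_integrable moments_intros f g)
  also have "\<dots> = (\<Sum>k\<le>m. of_nat (m choose k) * (\<integral>x. f x ^ k \<partial>gauss) * (\<integral>x. g x ^ (m - k) \<partial>gauss))"
  proof (intro sum.cong refl)
    fix k
    have "(\<integral>x. f x ^ k * g x ^ (m - k) \<partial>gauss) = (\<integral>x. f x ^ k \<partial>gauss) * (\<integral>x. g x ^ (m - k) \<partial>gauss)"
      by (intro integral_gauss_mult_independent[where I = I] moments_intros f(1) g(1)
          depends_on_comp[OF f(2)] depends_on_comp[OF g(2)])
    then show "(\<integral>x. of_nat (m choose k) * (f x ^ k * g x ^ (m - k)) \<partial>gauss) =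
        of_nat (m choose k) * (\<integral>x. f x ^ k \<partial>gauss) * (\<integral>x. g x ^ (m - k) \<partial>gauss)"
      by (simp add: mult.assoc)
  qed
  finally show ?thesis .
qed

text \<open>Shapes of independent summands add because the binomial convolution of rising factorials
  is the Chu-Vandermonde identity.\<close>

lemma gamma_moments_add:
  assumes "gamma_moments f a" "depends_on I f" "gamma_moments g b" "depends_on (- I) g"
  shows "gamma_moments (\<lambda>x. f x + g x) (a + b)"
  using assms
  by (auto simp: gamma_moments_def moments_intros integral_binomial_independent[where I = I]
      pochhammer_binomial_sum)

text \<open>Half the sum or difference of two independent standard normals has variance 1/2, and its
  square has shape 1/2. The sign \<open>s\<close> is 1 for real parts and -1 for imaginary parts of
  hermitized entries.\<close>

lemma gamma_moments_half:
  fixes s :: complex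
  assumes "c \<noteq> d" "s\<^sup>2 = 1"
  shows "gamma_moments (\<lambda>x. ((of_real (x c) + s * of_real (x d)) / 2)\<^sup>2) (1/2)"
  unfolding gamma_moments_def
proof (intro conjI allI)
  let ?f = "\<lambda>x::'a \<Rightarrow> real. complex_of_real (x c) / 2" and ?g = "\<lambda>x::'a \<Rightarrow> real. s / 2 * complex_of_real (x d)"
  have f: "all_moments gauss ?f" using moments_intros(3)[OF all_moments_component[of c] moments_intros(1)[of "1/2"]] by simp
  have g: "all_moments gauss ?g" by (intro moments_intros all_moments_component)
  have eq: "(\<lambda>x::'a \<Rightarrow> real. (of_real (x c) + s * of_real (x d)) / 2) = (\<lambda>x. ?f x + ?g x)"
    by (simp add: add_divide_distrib fun_eq_iff)
  show "all_moments gauss (\<lambda>x::'a \<Rightarrow> real. ((of_real (x c) + s * of_real (x d)) / 2)\<^sup>2)"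
    unfolding eq[unfolded fun_eq_iff, rule_format] by (intro moments_intros f g)
  fix m
  have s: "s ^ (2 * k) = 1" for k using assms(2) by (simp add: power_mult)
  have If: "(\<integral>x. ?f x ^ k \<partial>gauss) = of_real (normal_moment k) / 2 ^ k" for k
    by (simp add: power_divide integral_component_power)
  have Ig: "(\<integral>x. ?g x ^ k \<partial>gauss) = (s / 2) ^ k * of_real (normal_moment k)" for k
    by (simp only: power_mult_distrib integral_mult_right_zero integral_component_power)
  have "(\<integral>x. (((of_real (x c) + s * of_real (x d)) / 2)\<^sup>2) ^ m \<partial>gauss) = (\<integral>x. (?f x + ?g x) ^ (2 * m) \<partial>gauss)"
    unfolding eq[unfolded fun_eq_iff, rule_format] by (simp add: power_mult)
  also have "\<dots> = (\<Sum>k\<le>2 * m. of_nat (2 * m choose k) * (of_real (normal_moment k) / 2 ^ k) * ((s / 2) ^ (2 * m - k) * of_real (normal_moment (2 * m - k))))"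
    using assms(1) unfolding If[symmetric] Ig[symmetric]
    by (intro integral_binomial_independent[where I = "{c}"] f g depends_on_component depends_on_comp[where h="\<lambda>z. s / 2 * z"]) auto
  also have "\<dots> = (\<Sum>k\<le>m. of_nat (2 * m choose (2 * k)) * (of_real (normal_moment (2 * k)) / 2 ^ (2 * k)) * ((s / 2) ^ (2 * m - 2 * k) * of_real (normal_moment (2 * m - 2 * k))))"
    by (subst sum_even_indices) (simp_all add: normal_moment_def)
  \<comment> \<open>Once the odd indices are gone, only the binomial coefficient still depends on k.
    Of the power 2^(3 m), the halving contributes 2^(2 m) and the two normal moments together
    2^m.\<close>
  also have "\<dots> = (\<Sum>k\<le>m. of_real (fact (2 * m) / (2 ^ (3 * m) * fact m)) * of_nat (m choose k))"
  proof (intro sum.cong refl)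
    fix k assume "k \<in> {..m}"
    then obtain l where m: "m = k + l" using le_Suc_ex by auto
    have "real (2 * m choose (2 * k)) * normal_moment (2 * k) * normal_moment (2 * l)
       = fact (2 * m) / (2 ^ m * fact k * fact l)"
      using binomial_normal_moment[of k "2 * m"] by (simp add: normal_moment_def m power_add)
    also have "\<dots> = 2 ^ (2 * m) * (fact (2 * m) / (2 ^ (3 * m) * fact m) * real (m choose k))"
    proof -
      have "real (m choose k) = fact m / (fact k * fact l)" by (simp add: binomial_fact m)
      moreover have "(2::real) ^ (3 * m) = 2 ^ (2 * m) * 2 ^ m" by (simp flip: power_add)
      ultimately show ?thesis by simp
    qed
    finally have "complex_of_real (real (2 * m choose (2 * k)) * normal_moment (2 * k) * normal_moment (2 * l)) =
       of_real (2 ^ (2 * m) * (fact (2 * m) / (2 ^ (3 * m) * fact m) * real (m choose k)))"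
      by (rule arg_cong)
    moreover have "2 * m - 2 * k = 2 * l" by (simp add: m)
    moreover have "s ^ (l * 2) = 1" using s[of l] by (simp add: mult.commute)
    moreover have "(2::complex) ^ (2 * m) = 2 ^ (2 * k) * 2 ^ (2 * l)" by (simp add: m power_add)
    ultimately show "of_nat (2 * m choose (2 * k)) * (of_real (normal_moment (2 * k)) / 2 ^ (2 * k)) * ((s / 2) ^ (2 * m - 2 * k) * of_real (normal_moment (2 * m - 2 * k)))
      = of_real (fact (2 * m) / (2 ^ (3 * m) * fact m)) * complex_of_nat (m choose k)"
      by (simp add: power_divide field_simps)
  qed
  also have "\<dots> = of_real (fact (2 * m) / (2 ^ (3 * m) * fact m)) * of_nat (2 ^ m)"
    unfolding sum_distrib_left[symmetric] choose_row_sum[symmetric] of_nat_sum by (simp add: atLeast0AtMost)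
  also have "\<dots> = pochhammer (1/2) m"
  proof -
    have "fact (2 * m) / (2 ^ (3 * m) * fact m) * 2 ^ m = pochhammer (1/2::complex) m"
    proof -
      have "(2::complex) ^ (3 * m) = 2 ^ (2 * m) * 2 ^ m" by (simp flip: power_add)
      moreover have "fact (2 * m) = 2 ^ (2 * m) * pochhammer (1/2) m * (fact m :: complex)"
        using fact_parity[of "2 * m", where 'a = complex] by simp
      ultimately show ?thesis by simp
    qed
    then show ?thesis by simp
  qed
  finally show "(\<integral>x. (((of_real (x c) + s * of_real (x d)) / 2)\<^sup>2) ^ m \<partial>gauss) = pochhammer (1/2) m" .
qed

section \<open>Joint moments of consecutive minors\<close>

definition gue_matrix :: "('n::finite \<times> 'n \<times> bool \<Rightarrow> real) \<Rightarrow> complex ^ 'n ^ 'n" where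
  "gue_matrix x = hermitize (entry_matrix x)"

definition column_on :: "'n set \<Rightarrow> 'n \<Rightarrow> complex ^ 'n ^ 'n \<Rightarrow> complex ^ 'n" where
  "column_on S r H = (\<chi> i. if i \<in> S then H $ i $ r else 0)"

lemma gue_matrix_nth: "gue_matrix x $ i $ j = (of_real (x (i, j, False)) + of_real (x (j, i, False))) / 2
    + \<i> * ((of_real (x (i, j, True)) - of_real (x (j, i, True))) / 2)"
  by (simp add: gue_matrix_def hermitize_def conj_transpose_def entry_matrix_def complex_eq_iff)

lemma all_moments_gue_matrix: "all_moments gauss (\<lambda>x. gue_matrix x $ i $ j)"
proof -
  have "gue_matrix x $ i $ j = 1/2 * of_real (x (i, j, False)) + 1/2 * of_real (x (j, i, False))
    + (\<i>/2 * of_real (x (i, j, True)) + (-\<i>/2) * of_real (x (j, i, True)))" for x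
    by (simp add: gue_matrix_nth field_simps)
  then show ?thesis
    by (simp only:) (intro moments_intros all_moments_component)
qed

lemma all_moments_if: "(P \<Longrightarrow> all_moments M f) \<Longrightarrow> (\<not> P \<Longrightarrow> all_moments M g)
    \<Longrightarrow> all_moments M (\<lambda>x. if P then f x else g x)"
  by (cases P) simp_all

lemma all_moments_minor_det: "all_moments gauss (\<lambda>x. minor_det S (gue_matrix x))"
  unfolding minor_det_def
  by (intro moments_intros) (simp only: block_def proj_def vector_add_component vec_lambda_beta,
    intro moments_intros all_moments_if all_moments_gue_matrix)

lemma cnj_gue_matrix: "cnj (gue_matrix x $ i $ j) = gue_matrix x $ j $ i"
  by (simp add: gue_matrix_def hermitize_def conj_transpose_def add.commute)

lemma all_moments_bordered_det: "all_moments gauss (\<lambda>x. bordered_det S r (column_on S r (gue_matrix x)) (gue_matrix x))"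
  unfolding bordered_det_def
  by (intro moments_intros) (simp only: block_def proj_def outer_def cnj_vec_def column_on_def
     vector_add_component vec_lambda_beta if_distrib[of cnj] cnj_gue_matrix complex_cnj_zero,
    intro moments_intros all_moments_if all_moments_gue_matrix)

lemma measurable_nth_matrix[measurable]: "(\<lambda>K::complex ^ 'n ^ 'n::finite. K $ i $ j) \<in> borel_measurable borel"
  by (intro borel_measurable_continuous_onI continuous_intros)

lemma measurable_minor_det[measurable]: "minor_det S \<in> borel_measurable borel"
  unfolding minor_det_def det_def block_def proj_def vector_add_component vec_lambda_beta
  by measurable

lemma measurable_bordered_det[measurable]: "bordered_det S r b \<in> borel_measurable borel"
  unfolding bordered_det_def det_def block_def proj_def outer_def cnj_vec_def vector_add_component vec_lambda_beta
  by measurable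

lemma measurable_hermitize[measurable]: "hermitize \<in> borel_measurable borel"
  using borel_measurable_hermitization by (simp add: hermitize_def[abs_def])

section \<open>Unitary invariance of the Gaussian matrix\<close>

lemma integral_gauss_eq_ginibre:
  fixes \<psi> :: "complex ^ 'n ^ 'n::finite \<Rightarrow> complex"
  assumes [measurable]: "\<psi> \<in> borel_measurable borel"
  shows "(\<integral>x. \<psi> (entry_matrix x) \<partial>gauss) = (\<integral>G. \<psi> G \<partial>ginibre)"
  unfolding ginibre_def
  by (subst integral_distr) (simp_all add: entry_space_def[symmetric])

lemma integral_hunitary_invariant:
  fixes \<psi> :: "complex ^ 'n ^ 'n::finite \<Rightarrow> complex"
  assumes U: "hunitary_on S U" and [measurable]: "\<psi> \<in> borel_measurable borel"
  shows "(\<integral>x. \<psi> (U ** gue_matrix x ** U) \<partial>gauss) = (\<integral>x. \<psi> (gue_matrix x) \<partial>gauss)"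
proof -
  let ?T = "\<lambda>G. U ** G ** U"
  have T: "orthogonal_transformation ?T" by (rule orthogonal_hunitary_conj[OF U])
  have [measurable]: "?T \<in> borel_measurable borel"
    by (intro borel_measurable_continuous_onI linear_continuous_on linear_linear[THEN iffD2]
        orthogonal_transformation_linear T)
  have sg: "sets ginibre = sets (borel :: (complex ^ 'n ^ 'n) measure)" by (simp add: ginibre_def)
  have [measurable]: "?T \<in> measurable ginibre borel"
    by (simp add: measurable_cong_sets[OF sg refl])
  have "(\<integral>x. \<psi> (U ** gue_matrix x ** U) \<partial>gauss) = (\<integral>x. \<psi> (hermitize (?T (entry_matrix x))) \<partial>gauss)"
    by (simp add: gue_matrix_def hermitize_hunitary[OF U])
  also have "\<dots> = (\<integral>G. \<psi> (hermitize (?T G)) \<partial>ginibre)"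
    by (rule integral_gauss_eq_ginibre) measurable
  also have "\<dots> = (\<integral>G. \<psi> (hermitize G) \<partial>distr ginibre borel ?T)"
    by (subst integral_distr) simp_all
  also have "\<dots> = (\<integral>x. \<psi> (gue_matrix x) \<partial>gauss)"
    unfolding distr_ginibre_orthogonal[OF T] gue_matrix_def
    by (rule integral_gauss_eq_ginibre[symmetric]) measurable
  finally show ?thesis .
qed

section \<open>Averaging the bordered determinant\<close>

definition mixed_moment :: "'n::finite set \<Rightarrow> 'n \<Rightarrow> nat \<Rightarrow> nat \<Rightarrow> complex" where
  "mixed_moment S s i j = (\<integral>x. minor_det S (gue_matrix x) ^ i * minor_det (S - {s}) (gue_matrix x) ^ j \<partial>gauss)"

text \<open>With \<open>b\<close> fixed, the reflection taking it to the axis \<open>s\<close> is a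
  constant matrix, so invariance of the law applies to the whole integrand. The result sees
  \<open>b\<close> only through its squared norm.\<close>

lemma integral_bordered_det:
  assumes "s \<in> S" "r \<notin> S" and b: "\<And>i. i \<notin> S \<Longrightarrow> b $ i = 0"
  shows "(\<integral>x. bordered_det S r b (gue_matrix x) ^ m * minor_det S (gue_matrix x) ^ p \<partial>gauss)
     = (- 1) ^ m * cdot b b ^ m * mixed_moment S s p m"
proof -
  obtain U \<beta> where U: "hunitary_on S U" and Ub: "U *v b = \<beta> *s axis s 1" and \<beta>: "\<beta> * cnj \<beta> = cdot b b"
    using hunitary_reflection_exists[OF assms(1) b] by auto
  let ?\<psi> = "\<lambda>K. bordered_det S r (\<beta> *s axis s 1) K ^ m * minor_det S K ^ p"
  have "bordered_det S r b (gue_matrix x) ^ m * minor_det S (gue_matrix x) ^ p = ?\<psi> (U ** gue_matrix x ** U)" for x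
    using bordered_det_hunitary[OF U \<open>r \<notin> S\<close>, of b "gue_matrix x"] minor_det_hunitary[OF U, of "gue_matrix x"]
    by (simp add: Ub)
  then have "(\<integral>x. bordered_det S r b (gue_matrix x) ^ m * minor_det S (gue_matrix x) ^ p \<partial>gauss)
      = (\<integral>x. ?\<psi> (U ** gue_matrix x ** U) \<partial>gauss)"
    by simp
  also have "\<dots> = (\<integral>x. ?\<psi> (gue_matrix x) \<partial>gauss)"
    by (rule integral_hunitary_invariant[OF U]) measurable
  also have "\<dots> = (\<integral>x. ((- 1) ^ m * cdot b b ^ m) * (minor_det S (gue_matrix x) ^ p * minor_det (S - {s}) (gue_matrix x) ^ m) \<partial>gauss)"
  proof -
    have "(- c * d) ^ m * e = ((- 1) ^ m * c ^ m) * (e * d ^ m)" for c d e :: complex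
      unfolding power_mult_distrib power_minus[of c] by (simp only: mult.assoc mult.left_commute mult.commute)
    then show ?thesis
      unfolding bordered_det_axis[OF assms(1,2)] \<beta> by (simp only:)
  qed
  also have "\<dots> = (- 1) ^ m * cdot b b ^ m * mixed_moment S s p m"
    by (simp add: mixed_moment_def)
  finally show ?thesis .
qed

lemma block_cong: "(\<And>i j. i \<in> S \<Longrightarrow> j \<in> S \<Longrightarrow> H $ i $ j = K $ i $ j) \<Longrightarrow> block S H = block S K"
  by (auto simp: block_def vec_eq_iff)

text \<open>The squared modulus of an off-diagonal entry is a sum of two independent variables of
  shape 1/2, so it has shape 1; distinct entries of the column are independent and their shapes add
  up to \<open>card S\<close>.\<close>

lemma gamma_moments_column:
  assumes "r \<notin> S" "finite S"
  shows "gamma_moments (\<lambda>x. cdot (column_on S r (gue_matrix x)) (column_on S r (gue_matrix x))) (of_nat (card S))"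
proof -
  have single: "gamma_moments (\<lambda>x. cnj (gue_matrix x $ i $ r) * gue_matrix x $ i $ r) 1" if "i \<noteq> r" for i
  proof -
    have eq: "cnj (gue_matrix x $ i $ r) * gue_matrix x $ i $ r
       = ((of_real (x (i, r, False)) + 1 * of_real (x (r, i, False))) / 2)\<^sup>2
         + ((of_real (x (i, r, True)) + (-1) * of_real (x (r, i, True))) / 2)\<^sup>2" for x
      by (simp add: gue_matrix_nth complex_eq_iff power2_eq_square)
    have "gamma_moments (\<lambda>x. ((of_real (x (i, r, False)) + 1 * of_real (x (r, i, False))) / 2)\<^sup>2
         + ((of_real (x (i, r, True)) + (-1) * of_real (x (r, i, True))) / 2)\<^sup>2) (1/2 + 1/2)"
      using that
      by (intro gamma_moments_add[where I = "{(i, r, False), (r, i, False)}"] gamma_moments_half)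
        (auto simp: depends_on_def)
    then show ?thesis unfolding eq by simp
  qed
  have "gamma_moments (\<lambda>x. \<Sum>i\<in>S. cnj (gue_matrix x $ i $ r) * gue_matrix x $ i $ r) (of_nat (card S))"
    using assms(2,1)
  proof (induction S rule: finite_induct)
    case empty
    interpret G: prob_space "gauss :: ('a \<times> 'a \<times> bool \<Rightarrow> real) measure"
      by (rule prob_space_gauss)
    have "(\<integral>x. 0 ^ m \<partial>(gauss :: ('a \<times> 'a \<times> bool \<Rightarrow> real) measure)) = pochhammer (0::complex) m" for m
      using G.prob_space by (cases m) (simp_all add: pochhammer_0_left)
    then show ?case by (simp add: gamma_moments_def moments_intros)
  next
    case (insert i S)
    have "gamma_moments (\<lambda>x. cnj (gue_matrix x $ i $ r) * gue_matrix x $ i $ r + (\<Sum>i\<in>S. cnj (gue_matrix x $ i $ r) * gue_matrix x $ i $ r))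
       (1 + of_nat (card S))"
    \<comment> \<open>Hermitization mixes transposed positions, so the entry at (i, r) reads the
      coordinates at both (i, r) and (r, i).\<close>
    proof (rule gamma_moments_add[where I = "{i} \<times> {r} \<times> UNIV \<union> {r} \<times> {i} \<times> UNIV"])
      show "depends_on (- ({i} \<times> {r} \<times> UNIV \<union> {r} \<times> {i} \<times> UNIV)) (\<lambda>x. \<Sum>i\<in>S. cnj (gue_matrix x $ i $ r) * gue_matrix x $ i $ r)"
        unfolding depends_on_def
      proof (intro allI impI sum.cong refl)
        fix x y :: "'a \<times> 'a \<times> bool \<Rightarrow> real" and j
        assume eq: "\<forall>c\<in>- ({i} \<times> {r} \<times> UNIV \<union> {r} \<times> {i} \<times> UNIV). x c = y c" and "j \<in> S"
        then have "j \<noteq> i" "j \<noteq> r" using insert by auto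
        then have "x (j, r, t) = y (j, r, t)" "x (r, j, t) = y (r, j, t)" for t
          by (auto intro!: eq[rule_format])
        then have "gue_matrix x $ j $ r = gue_matrix y $ j $ r" by (simp add: gue_matrix_nth)
        then show "cnj (gue_matrix x $ j $ r) * gue_matrix x $ j $ r = cnj (gue_matrix y $ j $ r) * gue_matrix y $ j $ r" by simp
      qed
      show "depends_on ({i} \<times> {r} \<times> UNIV \<union> {r} \<times> {i} \<times> UNIV) (\<lambda>x. cnj (gue_matrix x $ i $ r) * gue_matrix x $ i $ r)"
        by (simp add: depends_on_def gue_matrix_nth)
    qed (use insert single in auto)
    then show ?case using insert by simp
  qed
  moreover have "cdot (column_on S r (gue_matrix x)) (column_on S r (gue_matrix x)) = (\<Sum>i\<in>S. cnj (gue_matrix x $ i $ r) * gue_matrix x $ i $ r)" for x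
  proof -
    have "cdot (column_on S r (gue_matrix x)) (column_on S r (gue_matrix x)) = (\<Sum>i\<in>UNIV. if i \<in> S then cnj (gue_matrix x $ i $ r) * gue_matrix x $ i $ r else 0)"
      unfolding cdot_def column_on_def by (intro sum.cong) auto
    then show ?thesis by (simp add: sum.If_cases)
  qed
  ultimately show ?thesis by simp
qed

lemma integral_bordered_det_column:
  assumes "s \<in> S" "r \<notin> S"
  shows "(\<integral>x. bordered_det S r (column_on S r (gue_matrix x)) (gue_matrix x) ^ m * minor_det S (gue_matrix x) ^ p \<partial>gauss)
     = (- 1) ^ m * pochhammer (of_nat (card S)) m * mixed_moment S s p m"
proof -
  \<comment> \<open>\<open>I\<close> holds the coordinates of the block on \<open>S\<close>. Those
    of the column involve \<open>r\<close>, which is not in \<open>S\<close>, so they stay frozen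
    during the inner integral.\<close>
  define I where "I = S \<times> S \<times> (UNIV :: bool set)"
  have blk: "block S (gue_matrix (\<lambda>c. if c \<in> I then x c else y c)) = block S (gue_matrix x)" for x y
    by (rule block_cong) (simp add: gue_matrix_nth I_def)
  have col: "column_on S r (gue_matrix (\<lambda>c. if c \<in> I then x c else y c)) = column_on S r (gue_matrix y)" for x y
    using assms(2) by (auto simp: column_on_def gue_matrix_nth I_def vec_eq_iff)
  have "(\<integral>x. bordered_det S r (column_on S r (gue_matrix x)) (gue_matrix x) ^ m * minor_det S (gue_matrix x) ^ p \<partial>gauss)
     = (\<integral>y. (\<integral>x. bordered_det S r (column_on S r (gue_matrix y)) (gue_matrix x) ^ m * minor_det S (gue_matrix x) ^ p \<partial>gauss) \<partial>gauss)"
    by (subst integral_PiM_merge[OF prob_space_std_normal, where I = I])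
      (intro all_moments_integrable moments_intros all_moments_bordered_det all_moments_minor_det,
       simp only: bordered_det_def minor_det_def blk col)
  also have "\<dots> = (\<integral>y. ((- 1) ^ m * mixed_moment S s p m) * cdot (column_on S r (gue_matrix y)) (column_on S r (gue_matrix y)) ^ m \<partial>gauss)"
    by (subst integral_bordered_det[OF assms]) (simp_all add: column_on_def ac_simps)
  also have "\<dots> = ((- 1) ^ m * mixed_moment S s p m) * pochhammer (of_nat (card S)) m"
    using gamma_moments_column[OF assms(2) finite] by (simp add: gamma_moments_def)
  finally show ?thesis by (simp add: ac_simps)
qed

text \<open>The diagonal entry at \<open>r\<close> is one standard normal coordinate, independent of
  the block and of the border. After binomial expansion its moments factor out, and averaging the
  power of the bordered determinant lowers the pair of minors by one size.\<close>

lemma mixed_moment_insert: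
  assumes "s \<in> S" "r \<notin> S"
  shows "mixed_moment (insert r S) r i j = (\<Sum>l\<le>i. of_nat (i choose l) * of_real (normal_moment l) * (- 1) ^ (i - l)
    * pochhammer (of_nat (card S)) (i - l) * mixed_moment S s (l + j) (i - l))"
proof -
  let ?a = "\<lambda>x. gue_matrix x $ r $ r" and ?d = "\<lambda>x. minor_det S (gue_matrix x)"
    and ?q = "\<lambda>x. bordered_det S r (column_on S r (gue_matrix x)) (gue_matrix x)"
  have a: "?a x = of_real (x (r, r, False))" for x by (simp add: gue_matrix_nth)
  have ins: "minor_det (insert r S) (gue_matrix x) = ?a x * ?d x + ?q x" for x
    unfolding column_on_def using assms(2)
    by (intro minor_det_insert) (simp_all add: gue_matrix_def conj_transpose_hermitize)
  \<comment> \<open>Block and column use only entries with row in \<open>S\<close>; hermitization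
    may swap row and column but never reaches (r, r).\<close>
  have dep: "depends_on (- {(r, r, False)}) (\<lambda>x. ?q x ^ m * ?d x ^ p)" for m p
  proof -
    have qd: "?q x = ?q y \<and> ?d x = ?d y" if "\<forall>c\<in>- {(r, r, False)}. x c = y c" for x y
    proof -
      have xy: "x (i, j, t) = y (i, j, t)" if "i \<noteq> r \<or> j \<noteq> r" for i j t
        using \<open>\<forall>c\<in>- {(r, r, False)}. x c = y c\<close> that by auto
      have "gue_matrix x $ i $ j = gue_matrix y $ i $ j" if "i \<in> S" for i j
      proof -
        have "i \<noteq> r" using that assms(2) by blast
        then show ?thesis by (simp add: gue_matrix_nth xy)
      qed
      then have "block S (gue_matrix x) = block S (gue_matrix y)" "column_on S r (gue_matrix x) = column_on S r (gue_matrix y)"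
        by (simp_all add: block_def column_on_def vec_eq_iff)
      then show ?thesis by (simp only: bordered_det_def minor_det_def)
    qed
    show ?thesis
      unfolding depends_on_def
    proof (intro allI impI)
      fix x y :: "'a \<times> 'a \<times> bool \<Rightarrow> real"
      assume "\<forall>c\<in>- {(r, r, False)}. x c = y c"
      from qd[OF this] show "?q x ^ m * ?d x ^ p = ?q y ^ m * ?d y ^ p" by (simp only:)
    qed
  qed
  have am: "all_moments gauss (\<lambda>x. ?a x ^ l)" "all_moments gauss (\<lambda>x. ?q x ^ m * ?d x ^ p)" for l m p
    by (intro moments_intros all_moments_gue_matrix all_moments_bordered_det all_moments_minor_det)+
  have summand: "(\<integral>x. ?a x ^ l * (?q x ^ m * ?d x ^ p) \<partial>gauss) =
     of_real (normal_moment l) * ((- 1) ^ m * pochhammer (of_nat (card S)) m * mixed_moment S s p m)" for l m p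
    by (subst integral_gauss_mult_independent[where I = "{(r, r, False)}", OF am(1) _ am(2) dep])
      (simp_all add: a integral_component_power integral_bordered_det_column[OF assms] depends_on_def)
  have "mixed_moment (insert r S) r i j = (\<integral>x. (?a x * ?d x + ?q x) ^ i * ?d x ^ j \<partial>gauss)"
    unfolding mixed_moment_def ins using assms(2) by simp
  also have "\<dots> = (\<integral>x. (\<Sum>l\<le>i. of_nat (i choose l) * (?a x ^ l * (?q x ^ (i - l) * ?d x ^ (l + j)))) \<partial>gauss)"
    unfolding binomial_ring sum_distrib_right
    by (intro Bochner_Integration.integral_cong sum.cong refl) (simp only: power_mult_distrib power_add ac_simps)
  also have "\<dots> = (\<Sum>l\<le>i. of_nat (i choose l) * (\<integral>x. ?a x ^ l * (?q x ^ (i - l) * ?d x ^ (l + j)) \<partial>gauss))"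
    by (subst Bochner_Integration.integral_sum)
      (intro all_moments_integrable moments_intros all_moments_gue_matrix all_moments_bordered_det all_moments_minor_det, simp)
  finally show ?thesis unfolding summand by (simp add: ac_simps)
qed

lemma minor_det_UNIV: "minor_det UNIV H = det H"
  unfolding minor_det_def by (rule arg_cong[where f = det]) (simp add: vec_eq_iff block_def proj_def)

lemma minor_det_empty: "minor_det {} H = 1"
proof -
  have "block {} H + proj (- {}) = mat 1" by (simp add: vec_eq_iff block_def proj_def mat_def)
  then show ?thesis by (simp add: minor_det_def)
qed

lemma minor_det_singleton: "minor_det {s} H = H $ s $ s"
proof -
  have "minor_det {s} H = (\<Prod>i\<in>UNIV. (block {s} H + proj (- {s})) $ i $ i)"
    unfolding minor_det_def by (rule det_diagonal) (auto simp: block_def proj_def)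
  also have "\<dots> = (\<Prod>i\<in>UNIV. if i = s then H $ s $ s else 1)"
    by (intro prod.cong) (auto simp: block_def proj_def)
  finally show ?thesis by simp
qed

text \<open>The induction quantifies over \<open>s\<close> as well as \<open>S\<close>: the
  recursion removes an arbitrary \<open>t\<close> from the smaller set, and the value depends on its
  cardinality only.\<close>

lemma mixed_moment_eq:
  assumes "s \<in> S"
  shows "mixed_moment S s i j = of_real (minor_moment (card S) i j)"
  using assms
proof (induction "card S" arbitrary: S s i j)
  case 0
  then show ?case by simp
next
  case (Suc n)
  define T where "T = S - {s}"
  have S: "S = insert s T" "s \<notin> T" using Suc.prems by (auto simp: T_def)
  have n: "n = card T" using Suc.hyps(2) S by simp
  show ?case
  proof (cases "T = {}")
    case True
    then show ?thesis
      using minor_moment_1[of i j]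
      by (simp add: S mixed_moment_def minor_det_singleton minor_det_empty gue_matrix_nth integral_component_power)
  next
    case False
    then obtain t where t: "t \<in> T" by blast
    have "n \<ge> 1" using False n by (simp add: Suc_le_eq card_gt_0_iff)
    have IH: "mixed_moment T t i j = of_real (minor_moment n i j)" for i j
      using Suc.hyps(1)[OF n t] n by simp
    have "pochhammer (complex_of_nat n) k = of_real (pochhammer (real n) k)" for k
      by (simp flip: pochhammer_of_real)
    then show ?thesis
      unfolding S(1) mixed_moment_insert[OF t S(2)] IH n[symmetric]
      using minor_moment_rec[OF \<open>n \<ge> 1\<close>, of i j] S(2) n by simp
  qed
qed

section \<open>Passage to the GUE\<close>

lemma GUE_eq_distr_gauss: "(GUE :: (complex ^ 'n ^ 'n::finite) measure) = distr gauss borel gue_matrix"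
proof -
  have "gue_matrix = hermitize \<circ> (entry_matrix :: ('n \<times> 'n \<times> bool \<Rightarrow> real) \<Rightarrow> _)"
    by (simp add: fun_eq_iff gue_matrix_def)
  then show ?thesis
    unfolding GUE_def ginibre_def hermitize_def[abs_def, symmetric] entry_space_def[symmetric]
    by (simp add: distr_distr)
qed

lemma measurable_det: "(det :: complex ^ 'n ^ 'n::finite \<Rightarrow> complex) \<in> borel_measurable borel"
  using measurable_minor_det[of UNIV] by (simp add: minor_det_UNIV[abs_def])

lemma has_bochner_integral_det_power_GUE:
  "has_bochner_integral GUE (\<lambda>H :: complex ^ 'n ^ 'n::finite. det H ^ k) (of_real (minor_moment CARD('n) k 0))"
proof -
  have [measurable]: "gue_matrix \<in> borel_measurable (gauss :: ('n \<times> 'n \<times> bool \<Rightarrow> real) measure)"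
    using measurable_comp[OF measurable_entry_matrix(1) measurable_hermitize]
    by (simp add: gue_matrix_def[abs_def] comp_def entry_space_def)
  note [measurable] = measurable_det
  have am: "all_moments gauss (\<lambda>x :: 'n \<times> 'n \<times> bool \<Rightarrow> real. det (gue_matrix x) ^ k)"
    unfolding minor_det_UNIV[symmetric] by (intro moments_intros all_moments_minor_det)
  \<comment> \<open>Any index will do, since the minor without it enters with exponent 0.\<close>
  obtain s :: 'n where True by simp
  have "(\<integral>x. det (gue_matrix x) ^ k \<partial>(gauss :: ('n \<times> 'n \<times> bool \<Rightarrow> real) measure)) = of_real (minor_moment CARD('n) k 0)"
    using mixed_moment_eq[of s UNIV k 0] by (simp add: mixed_moment_def minor_det_UNIV)
  then show ?thesis
    using all_moments_integrable[OF am]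
    unfolding GUE_eq_distr_gauss has_bochner_integral_iff
    by (simp add: integrable_distr_eq integral_distr)
qed

lemma of_real_prod_formula:
  "(\<Prod>i\<in>A. \<Prod>j\<in>B. 2 * of_int \<lfloor>real i / 2\<rfloor> + 2 * of_nat j - 1)
     = complex_of_real (\<Prod>i\<in>A. \<Prod>j\<in>B. 2 * real (i div 2) + 2 * real j - 1)"
proof -
  have "\<lfloor>real i / 2\<rfloor> = int (i div 2)" for i
    using floor_divide_of_nat_eq[of i 2, where 'a = real] by simp
  then show ?thesis by simp
qed

theorem corollary1:
  fixes P :: "'w measure"
    and M :: "'w \<Rightarrow> complex ^ 'n ^ 'n::finite"
    and k :: nat
  assumes "prob_space P"
    and "M \<in> borel_measurable P"
    and "distr P borel M = GUE"
    and "k \<ge> 1"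
  shows "integrable P (\<lambda>\<omega>. det (M \<omega>) ^ k) \<and>
    (even k \<longrightarrow>
      (LINT \<omega>|P. det (M \<omega>) ^ k) =
        (\<Prod>i\<in>{1..CARD('n)}. \<Prod>j\<in>{1..k div 2}. 2 * of_int \<lfloor>real i / 2\<rfloor> + 2 * of_nat j - 1)) \<and>
    (even CARD('n) \<longrightarrow>
      (LINT \<omega>|P. det (M \<omega>) ^ k) =
        (-1) ^ (CARD('n) * k div 2) *
        (\<Prod>i\<in>{1..k}. \<Prod>j\<in>{1..CARD('n) div 2}. 2 * of_int \<lfloor>real i / 2\<rfloor> + 2 * of_nat j - 1)) \<and>
    (odd CARD('n) \<and> odd k \<longrightarrow> (LINT \<omega>|P. det (M \<omega>) ^ k) = 0)"
proof -
  have M: "M \<in> measurable P borel" by (rule assms(2))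
  have det: "(\<lambda>H :: complex ^ 'n ^ 'n. det H ^ k) \<in> borel_measurable borel"
    using measurable_det by measurable
  \<comment> \<open>Integrability and value are both read off from the law of
    \<open>M\<close>.\<close>
  have int: "integrable P (\<lambda>\<omega>. det (M \<omega>) ^ k)"
    and eq: "(LINT \<omega>|P. det (M \<omega>) ^ k) = of_real (minor_moment CARD('n) k 0)"
    using has_bochner_integral_det_power_GUE[of k, where 'n = 'n]
    unfolding assms(3)[symmetric] has_bochner_integral_iff integrable_distr_eq[OF M det] integral_distr[OF M det]
    by auto
  show ?thesis
  proof (intro conjI impI)
    show "integrable P (\<lambda>\<omega>. det (M \<omega>) ^ k)" by (rule int)
  next
    assume "even k"
    then obtain q where k: "k = 2 * q" by blast
    have "CARD('n) \<ge> 1" by (simp add: Suc_le_eq card_gt_0_iff)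
    then show "(LINT \<omega>|P. det (M \<omega>) ^ k) =
        (\<Prod>i\<in>{1..CARD('n)}. \<Prod>j\<in>{1..k div 2}. 2 * of_int \<lfloor>real i / 2\<rfloor> + 2 * of_nat j - 1)"
      unfolding eq of_real_prod_formula by (simp only: k minor_moment_even_power) simp
  next
    assume "even CARD('n)"
    then obtain p where p: "CARD('n) = 2 * p" by blast
    have "p \<ge> 1" using p zero_less_card_finite[where 'a = 'n] by (cases p) simp_all
    \<comment> \<open>With \<open>CARD('n) = 2 * p\<close> the exponent of the sign is
      \<open>p * k\<close>.\<close>
    then show "(LINT \<omega>|P. det (M \<omega>) ^ k) =
        (-1) ^ (CARD('n) * k div 2) *
        (\<Prod>i\<in>{1..k}. \<Prod>j\<in>{1..CARD('n) div 2}. 2 * of_int \<lfloor>real i / 2\<rfloor> + 2 * of_nat j - 1)"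
      unfolding eq of_real_prod_formula p by (simp only: minor_moment_even_size) simp
  next
    assume "odd CARD('n) \<and> odd k"
    then show "(LINT \<omega>|P. det (M \<omega>) ^ k) = 0"
      unfolding eq by (simp add: minor_moment_def)
  qed
qed

end
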